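(* Let $m\geq0$ and $n\geq1$ be integers, let $N$ be an even integer with $N\geq n+m-1$, and let $A$ be an $(n+N)\times(n+N)$ skew-symmetric matrix with rows and columns indexed by $[n+N]$. Then \[ \sum_{\lambda:\ \ell(\lambda)\leq n}\ \sum_{\substack{c\in\mathcal{C}_{n,m}\\ \mathrm{sh}(c)=\lambda'}}(-1)^{|\lambda|}\operatorname{Pf}\big(A^{\overline{I_n(\lambda)}}_{\overline{I_n(\lambda)}}\big)\,\mathbf{t}^{\overline U(c)}\mathbf{x}^c =\operatorname{Pf}\begin{pmatrix}O_n&J_nB^N_{n,m}(\mathbf{t},\mathbf{x})\\-{}^tB^N_{n,m}(\mathbf{t},\mathbf{x})J_n&A\end{pmatrix}. \]
   Context: $\mathcal{C}_{n,m}$ is the set of plane partitions $c$ (nonnegative integer arrays with finitely many nonzero entries, weakly decreasing along rows and columns) with at most $n$ nonzero columns, nonzero entries strictly decreasing down columns, and each nonzero entry in column $j$ at most $n+m-j$; $\mathrm{sh}(c)$ is the partition whose $i$th part is the number of nonzero entries in row $i$, and $\lambda'$ is the conjugate of $\lambda$. $\mathcal{T}_{n,m}$ is the set of integer arrays $b=(b_{ij})_{1\le i\le j\le n+m-1}$ weakly decreasing along rows and columns with $\max\{n-i,0\}\le b_{ij}\le n$; $\Phi_{n,m}(c)=b$ with $b_{ij}=n-\#\{l:c_{n+m-j,l}\ge1-i+j\}$; with $b_{i,n+m}=n-i$, $b_{0,j}=n$, $U_r(b)=\sum_{s=1}^{n+m-r}(b_{s,s+r-1}-b_{s,s+r})+\sum_{s=n+m-r+1}^{n+m-1}\chi\{b_{s,n+m-1}>n-s\}$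 and $\overline U_r(c)=n+m-1-U_r(\Phi_{n,m}(c))$. For variables $\mathbf t=(t_1,\dots,t_{n+m})$, $\mathbf x=(x_1,\dots,x_{n+m})$, $\mathbf{t}^{\overline U(c)}\mathbf{x}^c=\prod_r t_r^{\overline U_r(c)}\prod_i x_i^{\mu_i}$, $\mu_i$ the number of entries equal to $i$ in $c$. $I_n(\lambda)=\{\lambda_n+1,\lambda_{n-1}+2,\dots,\lambda_1+n\}$ and $\overline I$ denotes the complement in $[n+N]$; $A^{K}_{K}$ is the principal submatrix on index set $K$. $O_n$ is the $n\times n$ zero matrix, $J_n=(\delta_{i,n+1-j})$. $B^N_{n,m}(\mathbf t,\mathbf x)=(b_{ij})_{0\le i\le n-1,\,0\le j\le n+N-1}$ with $b_{ij}=e^{(i+m)}_{j-i}(t_1x_1,\dots,t_{i+m-1}x_{i+m-1},T_{i+m}x_{i+m})$, $T_i=\prod_{k=i}^{n+m}t_k$, where $e^{(l)}_r$ is the $r$th elementary symmetric polynomial in $l$ variables ($0$ for $r<0$, and $\delta_{r,0}$ when $l=0$). $\operatorname{Pf}$ is the Pfaffian. *)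

theory Defs
  imports
    "HOL-Library.Groups_Big_Fun"
    "HOL-Combinatorics.Permutations"
    "Jordan_Normal_Form.Matrix"
    "Jordan_Normal_Form.DL_Submatrix"
begin

text \<open>
  Partitions and plane partitions are functions on indices starting at 1; entries at index 0 are
  required to vanish, so that equality of functions is equality of partitions.
\<close>

definition is_partition :: "(nat \<Rightarrow> nat) \<Rightarrow> bool" where
  "is_partition lam \<longleftrightarrow>
     lam 0 = 0 \<and> (\<forall>i\<ge>1. lam (Suc i) \<le> lam i) \<and> finite {i. lam i \<noteq> 0}"

definition part_length :: "(nat \<Rightarrow> nat) \<Rightarrow> nat" where
  "part_length lam = card {i. lam i \<noteq> 0}"

definition part_size :: "(nat \<Rightarrow> nat) \<Rightarrow> nat" where
  "part_size lam = (\<Sum>i\<in>{i. lam i \<noteq> 0}. lam i)"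

definition part_conj :: "(nat \<Rightarrow> nat) \<Rightarrow> nat \<Rightarrow> nat" where
  "part_conj lam j = (if j = 0 then 0 else card {i. 1 \<le> i \<and> j \<le> lam i})"

definition plane_partition :: "(nat \<Rightarrow> nat \<Rightarrow> nat) \<Rightarrow> bool" where
  "plane_partition c \<longleftrightarrow>
     (\<forall>i j. i = 0 \<or> j = 0 \<longrightarrow> c i j = 0) \<and>
     finite {(i, j). c i j \<noteq> 0} \<and>
     (\<forall>i\<ge>1. \<forall>j\<ge>1. c i (Suc j) \<le> c i j \<and> c (Suc i) j \<le> c i j)"

definition CC :: "nat \<Rightarrow> nat \<Rightarrow> (nat \<Rightarrow> nat \<Rightarrow> nat) set" where
  "CC n m = {c. plane_partition c \<and>
     card {j. \<exists>i. c i j \<noteq> 0} \<le> n \<and>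
     (\<forall>i\<ge>1. \<forall>j\<ge>1. c (Suc i) j \<noteq> 0 \<longrightarrow> c (Suc i) j < c i j) \<and>
     (\<forall>i j. c i j \<noteq> 0 \<longrightarrow> c i j + j \<le> n + m)}"

definition shape :: "(nat \<Rightarrow> nat \<Rightarrow> nat) \<Rightarrow> nat \<Rightarrow> nat" where
  "shape c i = card {j. c i j \<noteq> 0}"

definition multiplicity_in :: "(nat \<Rightarrow> nat \<Rightarrow> nat) \<Rightarrow> nat \<Rightarrow> nat" where
  "multiplicity_in c k = card {(i, j). c i j = k}"

text \<open>The arrays below are only used at positions with \<open>1 \<le> i \<le> j \<le> n + m - 1\<close>.\<close>

definition Phi :: "nat \<Rightarrow> nat \<Rightarrow> (nat \<Rightarrow> nat \<Rightarrow> nat) \<Rightarrow> nat \<Rightarrow> nat \<Rightarrow> int" where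
  "Phi n m c i j = int n - int (card {l. c (n + m - j) l \<ge> 1 + j - i})"

text \<open>
  Extension of an array by \<open>b\<^sub>i\<^sub>,\<^sub>n\<^sub>+\<^sub>m = n - i\<close> (possibly negative) and \<open>b\<^sub>0\<^sub>,\<^sub>j = n\<close>.
\<close>

definition extend_array :: "nat \<Rightarrow> nat \<Rightarrow> (nat \<Rightarrow> nat \<Rightarrow> int) \<Rightarrow> nat \<Rightarrow> nat \<Rightarrow> int" where
  "extend_array n m b i j =
     (if j = n + m then int n - int i else if i = 0 then int n else b i j)"

definition U_stat :: "nat \<Rightarrow> nat \<Rightarrow> nat \<Rightarrow> (nat \<Rightarrow> nat \<Rightarrow> int) \<Rightarrow> int" where
  "U_stat n m r b =
     (\<Sum>s=1..n+m-r. extend_array n m b s (s + r - 1) - extend_array n m b s (s + r)) +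
     (\<Sum>s=n+m-r+1..n+m-1. if extend_array n m b s (n + m - 1) > int n - int s then 1 else 0)"

definition Ubar :: "nat \<Rightarrow> nat \<Rightarrow> nat \<Rightarrow> (nat \<Rightarrow> nat \<Rightarrow> nat) \<Rightarrow> int" where
  "Ubar n m r c = int n + int m - 1 - U_stat n m r (Phi n m c)"

text \<open>The exponents are nonnegative, see \<open>Ubar_nonneg\<close> below, so \<open>nat\<close> does not truncate.\<close>

definition cc_weight ::
  "nat \<Rightarrow> nat \<Rightarrow> (nat \<Rightarrow> 'a::comm_ring_1) \<Rightarrow> (nat \<Rightarrow> 'a) \<Rightarrow> (nat \<Rightarrow> nat \<Rightarrow> nat) \<Rightarrow> 'a" where
  "cc_weight n m t x c =
     (\<Prod>r=1..n+m. t r ^ nat (Ubar n m r c)) * (\<Prod>i=1..n+m. x i ^ multiplicity_in c i)"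

definition I_set :: "nat \<Rightarrow> (nat \<Rightarrow> nat) \<Rightarrow> nat set" where
  "I_set n lam = {lam (n + 1 - k) + k | k. k \<in> {1..n}}"

text \<open>Matrices are indexed from 0, whereas the index set \<open>K\<close> is a set of indices starting at 1.\<close>

definition principal_submatrix :: "'a mat \<Rightarrow> nat set \<Rightarrow> 'a mat" where
  "principal_submatrix A K = submatrix A {i. Suc i \<in> K} {i. Suc i \<in> K}"

text \<open>
  Perfect matchings of \<open>{0..<d}\<close> are represented by the permutations \<open>p\<close> listing the blocks
  \<open>{p (2i), p (2i+1)}\<close> with increasing elements, ordered by their least elements.
\<close>

definition pfaffian :: "'a::comm_ring_1 mat \<Rightarrow> 'a" where
  "pfaffian A = (let d = dim_row A in
     if odd d then 0 else
       (\<Sum>p\<in>{p. p permutes {..<d} \<and>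
                 (\<forall>i<d div 2. p (2 * i) < p (2 * i + 1)) \<and>
                 (\<forall>i. i + 1 < d div 2 \<longrightarrow> p (2 * i) < p (2 * (i + 1)))}.
          of_int (sign p) * (\<Prod>i<d div 2. A $$ (p (2 * i), p (2 * i + 1)))))"

text \<open>Elementary symmetric polynomial of degree \<open>r\<close> in \<open>y 1, \<dots>, y l\<close>.\<close>

definition elem_sym :: "nat \<Rightarrow> int \<Rightarrow> (nat \<Rightarrow> 'a::comm_ring_1) \<Rightarrow> 'a" where
  "elem_sym l r y = (\<Sum>S\<in>{S. S \<subseteq> {1..l} \<and> int (card S) = r}. \<Prod>k\<in>S. y k)"

definition T_prod :: "nat \<Rightarrow> nat \<Rightarrow> (nat \<Rightarrow> 'a::comm_ring_1) \<Rightarrow> nat \<Rightarrow> 'a" where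
  "T_prod n m t i = (\<Prod>k=i..n+m. t k)"

definition B_mat ::
  "nat \<Rightarrow> nat \<Rightarrow> nat \<Rightarrow> (nat \<Rightarrow> 'a::comm_ring_1) \<Rightarrow> (nat \<Rightarrow> 'a) \<Rightarrow> 'a mat" where
  "B_mat n m N t x = mat n (n + N) (\<lambda>(i, j).
     elem_sym (i + m) (int j - int i)
       (\<lambda>k. if k = i + m then T_prod n m t k * x k else t k * x k))"

definition J_mat :: "nat \<Rightarrow> 'a::comm_ring_1 mat" where
  "J_mat n = mat n n (\<lambda>(i, j). if i + j + 1 = n then 1 else 0)"


lemma CC_bound:
  assumes "c \<in> CC n m"
  shows "c i j \<noteq> 0 \<Longrightarrow> 1 \<le> i \<and> 1 \<le> j \<and> c i j + i \<le> n + m \<and> c i j + j \<le> n + m"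
proof (induction i)
  case 0
  then show ?case using assms by (auto simp: CC_def plane_partition_def)
next
  case (Suc i)
  have j: "1 \<le> j" "c (Suc i) j + j \<le> n + m"
    using Suc.prems assms unfolding CC_def plane_partition_def
    by (auto simp: Suc_le_eq intro: gr0I)
  show ?case
  proof (cases "i = 0")
    case True
    then show ?thesis using j by auto
  next
    case False
    have "c (Suc i) j < c i j"
      using Suc.prems assms j False by (auto simp: CC_def)
    then show ?thesis using Suc.IH j by auto
  qed
qed

lemma finite_CC: "finite (CC n m)"
proof -
  let ?K = "{..n+m}"
  let ?G = "{g. \<forall>p. (p \<in> ?K \<times> ?K \<longrightarrow> g p \<in> ?K) \<and> (p \<notin> ?K \<times> ?K \<longrightarrow> g p = (0::nat))}"
  have "finite ?G"
    by (rule finite_set_of_finite_funs) auto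
  moreover have "CC n m \<subseteq> curry ` ?G"
  proof
    fix c assume c: "c \<in> CC n m"
    have "c i j \<noteq> 0 \<Longrightarrow> i \<le> n + m \<and> j \<le> n + m \<and> c i j \<le> n + m" for i j
      using CC_bound[OF c, of i j] by auto
    then have "case_prod c \<in> ?G" by force
    moreover have "c = curry (case_prod c)" by simp
    ultimately show "c \<in> curry ` ?G" by blast
  qed
  ultimately show ?thesis by (meson finite_imageI finite_subset)
qed

lemma part_conj_inj:
  assumes "is_partition lam" "is_partition mu" "part_conj lam = part_conj mu"
  shows "lam = mu"
proof -
  have *: "(j \<le> lam i) \<longleftrightarrow> i \<le> part_conj lam j" if "1 \<le> i" "1 \<le> j" "is_partition lam"
    for i j :: nat and lam
  proof -
    have mono: "lam b \<le> lam a" if "1 \<le> a" "a \<le> b" for a b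
      using that(2)
    proof (induction b rule: dec_induct)
      case (step k)
      then show ?case using \<open>is_partition lam\<close> \<open>1 \<le> a\<close>
        unfolding is_partition_def by (meson le_trans)
    qed simp
    let ?S = "{k. 1 \<le> k \<and> j \<le> lam k}"
    have fin: "finite ?S"
      by (rule finite_subset[of _ "{k. lam k \<noteq> 0}"])
        (use that in \<open>auto simp: is_partition_def\<close>)
    show ?thesis
    proof
      assume "j \<le> lam i"
      have "{1..i} \<subseteq> ?S"
      proof
        fix k assume "k \<in> {1..i}"
        then show "k \<in> ?S" using mono[of k i] \<open>j \<le> lam i\<close> by simp
      qed
      from card_mono[OF fin this] show "i \<le> part_conj lam j"
        using that by (simp add: part_conj_def)
    next
      assume "i \<le> part_conj lam j"
      then have "i \<le> card ?S" using that by (simp add: part_conj_def)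
      show "j \<le> lam i"
      proof (rule ccontr)
        assume "\<not> j \<le> lam i"
        have "?S \<subseteq> {1..<i}"
        proof
          fix k assume k: "k \<in> ?S"
          have "k < i"
          proof (rule ccontr)
            assume "\<not> k < i"
            then have "lam k \<le> lam i" using mono[of i k] that by simp
            then show False using k \<open>\<not> j \<le> lam i\<close> by simp
          qed
          then show "k \<in> {1..<i}" using k by simp
        qed
        then have "card ?S \<le> card {1..<i}" by (rule card_mono[rotated]) simp
        then show False using \<open>i \<le> card ?S\<close> that by simp
      qed
    qed
  qed
  show ?thesis
  proof
    fix i show "lam i = mu i"
    proof (cases "i = 0")
      case False
      then have "j \<le> lam i \<longleftrightarrow> j \<le> mu i" if "1 \<le> j" for j
        using *[of i j] assms that by auto
      from this[of "lam i"] this[of "mu i"] show ?thesis by linarith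
    qed (use assms in \<open>auto simp: is_partition_def\<close>)
  qed
qed

text \<open>Only finitely many partitions contribute to a sum over shapes of elements of \<open>CC n m\<close>.\<close>

lemma finite_support_shapes:
  fixes F :: "(nat \<Rightarrow> nat) \<Rightarrow> (nat \<Rightarrow> nat \<Rightarrow> nat) \<Rightarrow> 'a::comm_ring_1"
  shows "finite {lam. (if is_partition lam \<and> part_length lam \<le> n
                  then \<Sum>c\<in>{c \<in> CC n m. shape c = part_conj lam}. F lam c else 0) \<noteq> 0}"
    (is "finite {lam. ?P lam}")
proof -
  define S where "S = {lam. ?P lam}"
  have if_nz: "Q \<and> a \<noteq> 0" if "(if Q then a else 0) \<noteq> 0" for Q and a :: 'a
    using that by presburger
  have S: "is_partition lam \<and> part_conj lam \<in> shape ` CC n m" if "lam \<in> S" for lam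
  proof -
    from that have "?P lam" unfolding S_def by (rule CollectD)
    from if_nz[OF this] have part: "is_partition lam"
      and nz: "sum (F lam) {c \<in> CC n m. shape c = part_conj lam} \<noteq> 0" by simp_all
    from nz obtain c where "c \<in> {c \<in> CC n m. shape c = part_conj lam}"
      by (rule sum.not_neutral_contains_not_neutral)
    then have "c \<in> CC n m" "part_conj lam = shape c" by simp_all
    with part show ?thesis by blast
  qed
  have "part_conj ` S \<subseteq> shape ` CC n m" using S by blast
  then have "finite (part_conj ` S)"
    by (rule finite_subset) (rule finite_imageI[OF finite_CC])
  moreover have "inj_on part_conj S"
    by (rule inj_onI) (use S part_conj_inj in blast)
  ultimately have "finite S" by (rule finite_imageD)
  then show ?thesis unfolding S_def .
qed

lemma Ubar_nonneg:
  assumes c: "c \<in> CC n m" and r: "1 \<le> r" "r \<le> n + m"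
  shows "0 \<le> Ubar n m r c"
proof -
  let ?b = "extend_array n m (Phi n m c)"
  have fin: "finite {l. k \<le> c i l}" if "1 \<le> k" for k i
  proof (rule finite_subset)
    show "{l. k \<le> c i l} \<subseteq> {..n+m}"
    proof
      fix l assume "l \<in> {l. k \<le> c i l}"
      then have "c i l \<noteq> 0" using that by auto
      then show "l \<in> {..n+m}" using CC_bound[OF c, of i l] by auto
    qed
  qed simp
  have step: "?b (Suc s) j \<le> ?b s j" if "1 \<le> s" "Suc s \<le> j" for s j
  proof (cases "j = n + m")
    case False
    have "{l. c (n + m - j) l \<ge> 1 + j - s} \<subseteq> {l. c (n + m - j) l \<ge> 1 + j - Suc s}" by auto
    then have "card {l. c (n + m - j) l \<ge> 1 + j - s} \<le> card {l. c (n + m - j) l \<ge> 1 + j - Suc s}"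
      by (rule card_mono[rotated]) (use that in \<open>auto intro!: fin\<close>)
    then show ?thesis using that False by (simp add: extend_array_def Phi_def)
  qed (simp add: extend_array_def)
  have first: "(\<Sum>s=1..k. ?b s (s + r - 1) - ?b s (s + r)) \<le> int n - ?b k (k + r)"
    if "1 \<le> k" "k \<le> n + m - r" for k
    using that
  proof (induction k rule: dec_induct)
    case base
    then show ?case using r by (auto simp: extend_array_def Phi_def)
  next
    case (step k)
    then have "?b (Suc k) (k + r) \<le> ?b k (k + r)"
      using r \<open>\<And>s j. 1 \<le> s \<Longrightarrow> Suc s \<le> j \<Longrightarrow> ?b (Suc s) j \<le> ?b s j\<close> by simp
    then show ?case using step by simp
  qed
  have A: "(\<Sum>s=1..n+m-r. ?b s (s + r - 1) - ?b s (s + r)) \<le> int (n + m - r)"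
  proof (cases "n + m - r = 0")
    case False
    then have "(\<Sum>s=1..n+m-r. ?b s (s + r - 1) - ?b s (s + r))
        \<le> int n - ?b (n + m - r) (n + m - r + r)"
      by (intro first) auto
    then show ?thesis using r by (simp add: extend_array_def)
  qed simp
  have "(\<Sum>s=n+m-r+1..n+m-1. if ?b s (n + m - 1) > int n - int s then 1 else 0)
      \<le> (\<Sum>s=n+m-r+1..n+m-1. 1::int)"
    by (rule sum_mono) auto
  also have "\<dots> = int r - 1" using r by (simp add: of_nat_diff)
  finally show ?thesis using A r by (simp add: Ubar_def U_stat_def of_nat_diff)
qed

end

theory Submission
  imports Defs "Jordan_Normal_Form.Determinant"
begin

text \<open>
  Expanding the Pfaffian of the block matrix along its first \<open>n\<close> rows, and using that the upper left
  block vanishes, gives a signed sum over the \<open>n\<close>-subsets \<open>K\<close> of the columns of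
  (minor of \<open>B\<close> on \<open>K\<close>) times (Pfaffian of \<open>A\<close> on the complement of \<open>K\<close>).

  Row \<open>i\<close> of \<open>B\<close> is the coefficient sequence of \<open>z\<^sup>i \<Prod>\<^sub>l (1 + y\<^sub>l z)\<close> with \<open>1 \<le> l \<le> i + m\<close>, where the
  factor for \<open>l = i + m\<close> carries the special weight \<open>T\<^sub>l x\<^sub>l\<close>. Multiplying in the factors level by level,
  from \<open>l = n + m\<close> down to \<open>1\<close>, replaces each column \<open>k\<close> by itself plus a multiple of column \<open>k - 1\<close>.
  Expanding the minor multilinearly, the terms whose columns collide vanish, and what remains is a
  sum over nonintersecting families of lattice paths. The set of levels at which path \<open>i\<close> moves is
  column \<open>n - i\<close> of an array in \<open>CC n m\<close>; nonintersection means that the rows of the array are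
  weakly decreasing.
\<close>

section \<open>Pfaffians by expansion along the first row\<close>

text \<open>The special factor \<open>T_l x_l\<close> is attached to a row, whereas expanding
  columns needs multipliers common to all rows. The two are compatible because row \<open>i\<close>
  uses this factor only at its top level \<open>i + m\<close>, before its path has left position
  \<open>i\<close>. Levels above \<open>i + m\<close> get weight 0, so all rows can share one range
  of levels.

  In the array, this top step is the entry \<open>i + m\<close> in column \<open>n - i\<close>, the
  largest value permitted there, hence an entry of the first row. Since
  \<open>T_k = t_k ... t_{n+m}\<close>, each such entry \<open>k\<close> contributes an extra factor
  \<open>t_r\<close> for every \<open>r > k\<close>. The indicator terms of \<open>U_r\<close> count
  the first-row positions that miss this maximum, and its other terms give the multiplicity of
  \<open>r\<close>.

  The sign is that of the shuffle moving \<open>K\<close> in front of its complement. Matching the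
  first \<open>n\<close> rows produces minors with the rows reversed; \<open>J\<close> undoes the
  reversal, so no further sign arises, and the exponent is the sum of \<open>k_i - i\<close>, which
  is \<open>|lambda|\<close>.\<close>

definition skip :: "nat \<Rightarrow> nat \<Rightarrow> nat" where
  "skip j i = (if i < j then i else Suc i)"

lemma strict_mono_skip: "strict_mono (skip j)"
  by (auto simp: strict_mono_def skip_def)

lemma skip_less_iff [simp]: "skip j a < skip j b \<longleftrightarrow> a < b"
  using strict_mono_less[OF strict_mono_skip] .

lemma skip_eq_iff [simp]: "skip j a = skip j b \<longleftrightarrow> a = b"
  using strict_mono_eq[OF strict_mono_skip] .

lemma skip_image: "j \<le> n \<Longrightarrow> skip j ` {..<n} = {..n} - {j}"
proof (intro equalityI subsetI)
  fix x assume "j \<le> n" "x \<in> {..n} - {j}"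
  then show "x \<in> skip j ` {..<n}"
    by (intro image_eqI[of _ _ "if x < j then x else x - 1"]) (auto simp: skip_def)
qed (auto simp: skip_def split: if_splits)

text \<open>
  The cycle that puts \<open>Suc j\<close> at position \<open>1\<close> and keeps the order of all other points: in a matching,
  \<open>0\<close> is the first element of the first block and \<open>Suc j\<close> its partner.
\<close>

definition front_cycle :: "nat \<Rightarrow> nat \<Rightarrow> nat" where
  "front_cycle j i = (if i = 0 then 0 else if i = 1 then Suc j else Suc (skip j (i - 2)))"

lemma front_cycle_simps [simp]:
  "front_cycle j 0 = 0" "front_cycle j (Suc 0) = Suc j"
  "front_cycle j (Suc (Suc i)) = Suc (skip j i)"
  by (simp_all add: front_cycle_def)

lemma front_cycle_0: "front_cycle 0 = id"
  by (auto simp: front_cycle_def skip_def fun_eq_iff)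

text \<open>One adjacent transposition leads from \<open>j\<close> to \<open>Suc j\<close>, so the
  permutation property and the sign \<open>(-1) ^ j\<close> follow by induction.\<close>

lemma front_cycle_Suc:
  "front_cycle (Suc j) = transpose (Suc j) (Suc (Suc j)) \<circ> front_cycle j"
  by (auto simp: front_cycle_def skip_def fun_eq_iff transpose_def)

lemma front_cycle_permutes: "Suc j < d \<Longrightarrow> front_cycle j permutes {..<d}"
proof (induction j)
  case 0
  show ?case unfolding front_cycle_0 by (rule permutes_id)
next
  case (Suc j)
  then show ?case unfolding front_cycle_Suc
    by (intro permutes_compose permutes_swap_id) auto
qed

lemma sign_front_cycle: "sign (front_cycle j) = (-1) ^ j"
proof (induction j)
  case 0
  then show ?case by (simp add: front_cycle_0 sign_id)
next
  case (Suc j)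
  have "permutation (front_cycle j)"
    using front_cycle_permutes[of j "Suc (Suc j)"] by (auto intro: permutes_imp_permutation)
  then show ?case unfolding front_cycle_Suc
    by (subst sign_compose) (auto simp: Suc permutation_swap_id sign_swap_id)
qed

section \<open>Perfect matchings and removal of the block containing 0\<close>

definition pf_perms :: "nat \<Rightarrow> (nat \<Rightarrow> nat) set" where
  "pf_perms h = {p. p permutes {..<2 * h} \<and> (\<forall>i<h. p (2 * i) < p (2 * i + 1)) \<and>
     (\<forall>i. i + 1 < h \<longrightarrow> p (2 * i) < p (2 * (i + 1)))}"

definition lift2 :: "nat \<Rightarrow> (nat \<Rightarrow> nat) \<Rightarrow> nat \<Rightarrow> nat" where
  "lift2 h p = map_permutation {..<2 * h} (\<lambda>i. Suc (Suc i)) p"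

lemma image_SucSuc: "(\<lambda>i. Suc (Suc i)) ` {..<d} = {2..<d + 2}"
proof (intro equalityI subsetI)
  fix x assume "x \<in> {2..<d + 2}"
  then show "x \<in> (\<lambda>i. Suc (Suc i)) ` {..<d}"
    by (intro image_eqI[of _ _ "x - 2"]) auto
qed auto

lemma lift2_permutes:
  assumes "p permutes {..<2 * h}"
  shows "lift2 h p permutes {2..<2 * h + 2}"
  unfolding lift2_def
  by (rule map_permutation_permutes[OF _ assms])
     (simp add: bij_betw_def image_SucSuc inj_on_def)

lemma lift2_simps:
  assumes "p permutes {..<2 * h}"
  shows "lift2 h p 0 = 0" "lift2 h p (Suc 0) = Suc 0"
    "i < 2 * h \<Longrightarrow> lift2 h p (Suc (Suc i)) = Suc (Suc (p i))"
proof -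
  show "lift2 h p 0 = 0" "lift2 h p (Suc 0) = Suc 0"
    using lift2_permutes[OF assms] by (auto intro: permutes_not_in)
  show "i < 2 * h \<Longrightarrow> lift2 h p (Suc (Suc i)) = Suc (Suc (p i))"
    unfolding lift2_def
    by (rule map_permutation_apply[of "\<lambda>i. Suc (Suc i)"]) (auto simp: inj_on_def)
qed

lemma sign_lift2:
  assumes "p permutes {..<2 * h}"
  shows "sign (lift2 h p) = sign p"
  unfolding lift2_def
  by (rule sign_map_permutation[OF _ assms]) (auto simp: inj_on_def)

text \<open>Adds the block of 0 and \<open>Suc j\<close> to a matching of the other points, which
  keep their relative order. The sign changes only by that of the cycle.\<close>

definition pf_extend :: "nat \<Rightarrow> nat \<Rightarrow> (nat \<Rightarrow> nat) \<Rightarrow> nat \<Rightarrow> nat" where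
  "pf_extend h j p = front_cycle j \<circ> lift2 h p"

lemma pf_extend_simps:
  assumes "p permutes {..<2 * h}"
  shows "pf_extend h j p 0 = 0" "pf_extend h j p (Suc 0) = Suc j"
    "i < 2 * h \<Longrightarrow> pf_extend h j p (Suc (Suc i)) = Suc (skip j (p i))"
  by (simp_all add: pf_extend_def lift2_simps[OF assms])

lemma pf_extend_permutes:
  assumes "p permutes {..<2 * h}" "j < 2 * h + 1"
  shows "pf_extend h j p permutes {..<2 * Suc h}"
  unfolding pf_extend_def
proof (rule permutes_compose)
  show "lift2 h p permutes {..<2 * Suc h}"
    by (rule permutes_subset[OF lift2_permutes[OF assms(1)]]) auto
  show "front_cycle j permutes {..<2 * Suc h}"
    using assms(2) by (intro front_cycle_permutes) auto
qed

lemma sign_pf_extend: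
  assumes "p permutes {..<2 * h}"
  shows "sign (pf_extend h j p) = (-1) ^ j * sign p"
proof -
  have "permutation (front_cycle j)"
    using front_cycle_permutes[of j "Suc (Suc j)"] by (auto intro: permutes_imp_permutation)
  moreover have "permutation (lift2 h p)"
    using lift2_permutes[OF assms] by (auto intro: permutes_imp_permutation)
  ultimately show ?thesis
    by (simp add: pf_extend_def sign_compose sign_front_cycle sign_lift2[OF assms])
qed

lemma pf_perms_permutes: "p \<in> pf_perms h \<Longrightarrow> p permutes {..<2 * h}"
  by (simp add: pf_perms_def)

text \<open>Every point is at least the first element of its block, and these first elements
  increase from \<open>p 0\<close>; so \<open>p 0\<close> is the minimum.\<close>

lemma pf_perms_0:
  assumes "p \<in> pf_perms (Suc h)"
  shows "p 0 = 0"
proof -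
  note p = assms[unfolded pf_perms_def mem_Collect_eq]
  have even_pos: "p 0 \<le> p (2 * i)" if "i < Suc h" for i
    using that
  proof (induction i)
    case (Suc i)
    then have "p (2 * i) < p (2 * (i + 1))" using p by auto
    then show ?case using Suc by auto
  qed simp
  have le: "p 0 \<le> p y" if "y < 2 * Suc h" for y
  proof (cases "even y")
    case True
    then show ?thesis using that even_pos by (auto elim!: evenE)
  next
    case False
    then obtain i where y: "y = 2 * i + 1" by (rule oddE)
    then have "p (2 * i) < p (2 * i + 1)" using that p by simp
    then show ?thesis using even_pos[of i] that y by simp
  qed
  have "0 \<in> p ` {..<2 * Suc h}" using p permutes_image[of p "{..<2 * Suc h}"] by auto
  then obtain y where "y < 2 * Suc h" "p y = 0" by auto
  then show ?thesis using le[of y] by simp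
qed

text \<open>A matching is determined by the partner of 0 and the matching induced on the remaining
  points.\<close>

lemma bij_betw_pf_extend:
  "bij_betw (\<lambda>(j, p). pf_extend h j p) ({..<2 * h + 1} \<times> pf_perms h) (pf_perms (Suc h))"
proof (rule bij_betw_imageI)
  show "inj_on (\<lambda>(j, p). pf_extend h j p) ({..<2 * h + 1} \<times> pf_perms h)"
  proof (rule inj_onI, clarify)
    fix i j p q
    assume p: "p \<in> pf_perms h" and q: "q \<in> pf_perms h"
      and eq: "pf_extend h i p = pf_extend h j q"
    note P = pf_perms_permutes[OF p] note Q = pf_perms_permutes[OF q]
    have "pf_extend h i p (Suc 0) = pf_extend h j q (Suc 0)" by (simp add: eq)
    then have ij: "i = j" by (simp add: pf_extend_simps[OF P] pf_extend_simps[OF Q])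
    have "p a = q a" for a
    proof (cases "a < 2 * h")
      case True
      have "pf_extend h i p (Suc (Suc a)) = pf_extend h j q (Suc (Suc a))" by (simp add: eq)
      then show ?thesis
        by (simp add: pf_extend_simps[OF P] pf_extend_simps[OF Q] True ij)
    next
      case False
      then show ?thesis using P Q by (simp add: permutes_not_in)
    qed
    then show "i = j \<and> p = q" using ij by auto
  qed
  show "(\<lambda>(j, p). pf_extend h j p) ` ({..<2 * h + 1} \<times> pf_perms h) = pf_perms (Suc h)"
  proof (intro equalityI subsetI)
    fix r assume "r \<in> (\<lambda>(j, p). pf_extend h j p) ` ({..<2 * h + 1} \<times> pf_perms h)"
    then obtain j p where jp: "j < 2 * h + 1" "p \<in> pf_perms h" and r: "r = pf_extend h j p"
      by auto
    note P = pf_perms_permutes[OF jp(2)]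
    note S = pf_extend_simps[OF P]
    have "r (2 * i) < r (2 * i + 1)" if "i < Suc h" for i
    proof (cases i)
      case (Suc i')
      then show ?thesis using that jp by (simp add: r S pf_perms_def)
    qed (simp add: r S)
    moreover have "r (2 * i) < r (2 * (i + 1))" if "i + 1 < Suc h" for i
    proof (cases i)
      case (Suc i')
      then show ?thesis using that jp by (simp add: r S pf_perms_def)
    qed (use that S(3)[of 0] in \<open>simp add: r S numeral_2_eq_2\<close>)
    ultimately show "r \<in> pf_perms (Suc h)"
      using pf_extend_permutes[OF P jp(1)] by (simp add: pf_perms_def r)
  next
    fix r assume r: "r \<in> pf_perms (Suc h)"
    note R = pf_perms_permutes[OF r]
    have inj: "r a = r b \<longleftrightarrow> a = b" for a b using permutes_inj[OF R] by (auto simp: inj_def)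
    have r0: "r 0 = 0" by (rule pf_perms_0[OF r])
    have lt: "r a < 2 * Suc h" if "a < 2 * Suc h" for a
      using permutes_in_image[OF R, of a] that by simp
    define j where "j = r 1 - 1"
    have r1: "r (Suc 0) = Suc j" using inj[of 1 0] r0 by (simp add: j_def)
    have j: "j < 2 * h + 1" using lt[of 1] r1 by simp
    \<comment> \<open>Inverts the renumbering made by \<open>pf_extend\<close>. At these positions
      \<open>r\<close> avoids 0 and \<open>Suc j\<close>, so a preimage under \<open>skip j\<close>
      exists.\<close>
    define p where "p i = (if i < 2 * h then inv_into UNIV (skip j) (r (Suc (Suc i)) - 1) else i)" for i
    have skip_p: "Suc (skip j (p i)) = r (Suc (Suc i))" and p_lt: "p i < 2 * h" if "i < 2 * h" for i
    proof -
      have "r (Suc (Suc i)) \<noteq> 0" using inj[of "Suc (Suc i)" 0] r0 by simp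
      moreover have "r (Suc (Suc i)) \<noteq> Suc j" using inj[of "Suc (Suc i)" 1] r1 by simp
      moreover have "r (Suc (Suc i)) < 2 * Suc h" using lt that by simp
      ultimately have "r (Suc (Suc i)) - 1 \<in> {..2 * h} - {j}" by auto
      then have "r (Suc (Suc i)) - 1 \<in> skip j ` {..<2 * h}"
        using j by (subst skip_image) auto
      then obtain b where b: "r (Suc (Suc i)) - 1 = skip j b" "b < 2 * h" by auto
      have "p i = b" using that b by (simp add: p_def inv_f_f[of "skip j"] inj_def)
      then show "Suc (skip j (p i)) = r (Suc (Suc i))" "p i < 2 * h"
        using b \<open>r (Suc (Suc i)) \<noteq> 0\<close> by auto
    qed
    have P: "p permutes {..<2 * h}"
    proof (rule bij_imp_permutes)
      have inj_p: "inj_on p {..<2 * h}"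
      proof (rule inj_onI)
        fix a b assume "a \<in> {..<2 * h}" "b \<in> {..<2 * h}" "p a = p b"
        then show "a = b" using skip_p[of a] skip_p[of b] inj[of "Suc (Suc a)" "Suc (Suc b)"] by auto
      qed
      moreover have "p ` {..<2 * h} \<subseteq> {..<2 * h}" using p_lt by auto
      ultimately show "bij_betw p {..<2 * h} {..<2 * h}"
        by (simp add: bij_betw_def endo_inj_surj)
    qed (simp add: p_def)
    have "p \<in> pf_perms h"
      unfolding pf_perms_def
    proof (intro CollectI conjI allI impI P)
      fix i assume i: "i < h"
      then have "Suc i < Suc h" by simp
      then have "r (2 * Suc i) < r (2 * Suc i + 1)" using r unfolding pf_perms_def by blast
      then have "Suc (skip j (p (2 * i))) < Suc (skip j (p (2 * i + 1)))"
        using skip_p[of "2 * i"] skip_p[of "2 * i + 1"] i by simp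
      then show "p (2 * i) < p (2 * i + 1)" by simp
    next
      fix i assume i: "i + 1 < h"
      then have "Suc i + 1 < Suc h" by simp
      then have "r (2 * Suc i) < r (2 * (Suc i + 1))" using r unfolding pf_perms_def by blast
      then have "Suc (skip j (p (2 * i))) < Suc (skip j (p (2 * (i + 1))))"
        using skip_p[of "2 * i"] skip_p[of "2 * (i + 1)"] i by simp
      then show "p (2 * i) < p (2 * (i + 1))" by simp
    qed
    moreover have "r = pf_extend h j p"
    proof
      fix a
      consider "a = 0" | "a = 1" | i where "a = Suc (Suc i)" "i < 2 * h" | "a \<ge> 2 * Suc h"
      proof -
        consider "a < 2" | i where "a = i + 2" by (metis add.commute le_Suc_ex not_less)
        then show thesis
        proof cases
          case 1
          then show thesis using that(1,2) by linarith
        next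
          case (2 i)
          then show thesis using that(3)[of i] that(4) by (cases "i < 2 * h") auto
        qed
      qed
      then show "r a = pf_extend h j p a"
      proof cases
        case 4
        then show ?thesis using R pf_extend_permutes[OF P j] by (simp add: permutes_not_in)
      qed (simp_all add: pf_extend_simps[OF P] r0 r1 skip_p)
    qed
    ultimately show "r \<in> (\<lambda>(j, p). pf_extend h j p) ` ({..<2 * h + 1} \<times> pf_perms h)"
      using j by (auto intro!: image_eqI[of _ _ "(j, p)"])
  qed
qed

section \<open>Recursive expansion of the Pfaffian, over positions and over index sets\<close>

definition matching_sum :: "nat \<Rightarrow> (nat \<Rightarrow> nat \<Rightarrow> 'a::comm_ring_1) \<Rightarrow> 'a" where
  "matching_sum h a =
     (\<Sum>p\<in>pf_perms h. of_int (sign p) * (\<Prod>i<h. a (p (2 * i)) (p (2 * i + 1))))"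

lemma pfaffian_eq_matching_sum:
  assumes "dim_row A = 2 * h"
  shows "pfaffian A = matching_sum h (\<lambda>i j. A $$ (i, j))"
  using assms by (simp add: pfaffian_def matching_sum_def pf_perms_def)

lemma matching_sum_Suc:
  "matching_sum (Suc h) a = (\<Sum>j<2 * h + 1. (-1) ^ j * a 0 (Suc j) *
     matching_sum h (\<lambda>i k. a (Suc (skip j i)) (Suc (skip j k))))"
proof -
  have "matching_sum (Suc h) a = (\<Sum>(j, p)\<in>{..<2 * h + 1} \<times> pf_perms h.
      of_int (sign (pf_extend h j p)) *
      (\<Prod>i<Suc h. a (pf_extend h j p (2 * i)) (pf_extend h j p (2 * i + 1))))"
    unfolding matching_sum_def
    by (subst sum.reindex_bij_betw[OF bij_betw_pf_extend, symmetric]) (simp add: case_prod_unfold)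
  also have "\<dots> = (\<Sum>(j, p)\<in>{..<2 * h + 1} \<times> pf_perms h. (-1) ^ j * a 0 (Suc j) *
      (of_int (sign p) *
       (\<Prod>i<h. a (Suc (skip j (p (2 * i)))) (Suc (skip j (p (2 * i + 1)))))))"
  proof (intro sum.cong refl, clarify)
    fix j p assume "p \<in> pf_perms h"
    note P = pf_perms_permutes[OF this]
    note S = pf_extend_simps[OF P]
    have "(\<Prod>i<Suc h. a (pf_extend h j p (2 * i)) (pf_extend h j p (2 * i + 1)))
        = a 0 (Suc j) * (\<Prod>i<h. a (Suc (skip j (p (2 * i)))) (Suc (skip j (p (2 * i + 1)))))"
      by (subst prod.lessThan_Suc_shift) (auto simp: S intro!: prod.cong)
    then show "of_int (sign (pf_extend h j p)) *
        (\<Prod>i<Suc h. a (pf_extend h j p (2 * i)) (pf_extend h j p (2 * i + 1))) =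
        (-1) ^ j * a 0 (Suc j) * (of_int (sign p) *
         (\<Prod>i<h. a (Suc (skip j (p (2 * i)))) (Suc (skip j (p (2 * i + 1))))))"
      by (simp add: sign_pf_extend[OF P] mult_ac)
  qed
  also have "\<dots> = (\<Sum>j<2 * h + 1. (-1) ^ j * a 0 (Suc j) *
     matching_sum h (\<lambda>i k. a (Suc (skip j i)) (Suc (skip j k))))"
    by (simp add: matching_sum_def sum_distrib_left sum.cartesian_product)
  finally show ?thesis .
qed

text \<open>The value is the Pfaffian of \<open>a\<close> on \<open>S\<close> only if \<open>card S = 2 * h\<close>.\<close>

fun set_pf :: "(nat \<Rightarrow> nat \<Rightarrow> 'a::comm_ring_1) \<Rightarrow> nat \<Rightarrow> nat set \<Rightarrow> 'a" where
  "set_pf a 0 S = 1"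
| "set_pf a (Suc h) S = (\<Sum>y\<in>S - {Min S}. (-1) ^ card {z \<in> S. Min S < z \<and> z < y} *
     a (Min S) y * set_pf a h (S - {Min S, y}))"

text \<open>Trades renumbered indices for index sets, from which rows and columns can be deleted
  without composing relabellings.\<close>

lemma matching_sum_eq_set_pf:
  assumes "strict_mono_on {..<2 * h} s"
  shows "matching_sum h (\<lambda>i j. a (s i) (s j)) = set_pf a h (s ` {..<2 * h})"
  using assms
proof (induction h arbitrary: s)
  case 0
  then show ?case by (simp add: matching_sum_def pf_perms_def)
next
  case (Suc h)
  let ?S = "s ` {..<2 * Suc h}" and ?n = "2 * h + 1"
  have less: "s i < s j \<longleftrightarrow> i < j" if "i < Suc ?n" "j < Suc ?n" for i j
    using Suc.prems that by (simp add: strict_mono_on_less)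
  have eq: "s i = s j \<longleftrightarrow> i = j" if "i < Suc ?n" "j < Suc ?n" for i j
    using Suc.prems that by (simp add: strict_mono_on_eq)
  have S: "?S = insert (s 0) ((\<lambda>i. s (Suc i)) ` {..<?n})"
    by (simp add: lessThan_Suc_eq_insert_0 image_image)
  have Min: "Min ?S = s 0"
    by (rule Min_eqI) (auto simp: le_less less eq)
  have S0: "?S - {s 0} = (\<lambda>i. s (Suc i)) ` {..<?n}"
    unfolding S by (auto simp: eq)
  have inj: "inj_on (\<lambda>i. s (Suc i)) {..<?n}" by (auto simp: inj_on_def eq)
  have card: "card {z \<in> ?S. s 0 < z \<and> z < s (Suc j)} = j" if "j < ?n" for j
  proof -
    have "{z \<in> ?S. s 0 < z \<and> z < s (Suc j)} = (\<lambda>i. s (Suc i)) ` {..<j}"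
      using that unfolding S by (auto simp: less)
    then show ?thesis using that by (simp add: card_image inj_on_subset[OF inj])
  qed
  have rest: "?S - {s 0, s (Suc j)} = (\<lambda>i. s (Suc (skip j i))) ` {..<2 * h}" if "j < ?n" for j
  proof -
    have "(\<lambda>i. s (Suc (skip j i))) ` {..<2 * h} = (\<lambda>i. s (Suc i)) ` (skip j ` {..<2 * h})"
      by (simp add: image_image)
    also have "skip j ` {..<2 * h} = {..<?n} - {j}"
      using that by (subst skip_image) auto
    also have "(\<lambda>i. s (Suc i)) ` \<dots> = ?S - {s 0, s (Suc j)}"
      using that unfolding S by (auto simp: eq)
    finally show ?thesis ..
  qed
  have "set_pf a (Suc h) ?S = (\<Sum>j<?n. (-1) ^ j * a (s 0) (s (Suc j)) *
      set_pf a h ((\<lambda>i. s (Suc (skip j i))) ` {..<2 * h}))"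
    unfolding set_pf.simps Min S0 sum.reindex[OF inj] o_def
  proof (rule sum.cong[OF refl])
    fix j assume "j \<in> {..<?n}"
    then show "(-1) ^ card {z \<in> ?S. s 0 < z \<and> z < s (Suc j)} * a (s 0) (s (Suc j)) *
        set_pf a h (?S - {s 0, s (Suc j)}) = (-1) ^ j * a (s 0) (s (Suc j)) *
        set_pf a h ((\<lambda>i. s (Suc (skip j i))) ` {..<2 * h})"
      using card[of j] rest[of j] by (simp only: lessThan_iff)
  qed
  also have "\<dots> = (\<Sum>j<?n. (-1) ^ j * a (s 0) (s (Suc j)) *
      matching_sum h (\<lambda>i k. a (s (Suc (skip j i))) (s (Suc (skip j k)))))"
  proof (intro sum.cong refl arg_cong2[where f="(*)"])
    fix j assume "j \<in> {..<?n}"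
    have "strict_mono_on {..<2 * h} (\<lambda>i. s (Suc (skip j i)))"
      by (rule strict_mono_onI) (use Suc.prems in \<open>auto simp: less skip_def\<close>)
    from Suc.IH[OF this]
    show "set_pf a h ((\<lambda>i. s (Suc (skip j i))) ` {..<2 * h}) =
      matching_sum h (\<lambda>i k. a (s (Suc (skip j i))) (s (Suc (skip j k))))" by simp
  qed
  also have "\<dots> = matching_sum (Suc h) (\<lambda>i j. a (s i) (s j))"
    by (simp add: matching_sum_Suc)
  finally show ?case by simp
qed

lemma pfaffian_eq_set_pf:
  assumes "dim_row A = 2 * h"
  shows "pfaffian A = set_pf (\<lambda>i j. A $$ (i, j)) h {..<2 * h}"
  using matching_sum_eq_set_pf[of h "\<lambda>i. i" "\<lambda>i j. A $$ (i, j)"]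
  by (simp add: pfaffian_eq_matching_sum[OF assms] strict_mono_on_def)

section \<open>Pfaffians with a zero block\<close>

text \<open>Laplace expansion along the last row, with columns named by a set. It runs in step with
  \<open>set_pf\<close>: removing the least index \<open>n - Suc q\<close> removes row
  \<open>q\<close> of \<open>\<lambda>i. a (n - Suc i)\<close>.\<close>

fun row_minor :: "nat \<Rightarrow> (nat \<Rightarrow> nat \<Rightarrow> 'a::comm_ring_1) \<Rightarrow> nat set \<Rightarrow> 'a" where
  "row_minor 0 f K = 1"
| "row_minor (Suc q) f K =
     (\<Sum>k\<in>K. (-1) ^ card {z \<in> K. k < z} * f q k * row_minor q f (K - {k}))"

lemma minus_one_power_cong: "even a = even b \<Longrightarrow> (-1::'a::ring_1) ^ a = (-1) ^ b"
  by (simp add: minus_one_power_iff)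

lemma row_minor_eq_det:
  assumes "strict_mono_on {..<q} k"
  shows "row_minor q f (k ` {..<q}) = det (mat q q (\<lambda>(i, j). f i (k j)))"
  using assms
proof (induction q arbitrary: k)
  case 0
  then show ?case by simp
next
  case (Suc q)
  let ?K = "k ` {..<Suc q}" and ?A = "mat (Suc q) (Suc q) (\<lambda>(i, j). f i (k j))"
  have less: "k i < k j \<longleftrightarrow> i < j" if "i < Suc q" "j < Suc q" for i j
    using Suc.prems that by (simp add: strict_mono_on_less)
  have eq: "k i = k j \<longleftrightarrow> i = j" if "i < Suc q" "j < Suc q" for i j
    using Suc.prems that by (simp add: strict_mono_on_eq)
  have inj: "inj_on k {..<Suc q}" by (auto simp: inj_on_def eq)
  have card: "card {z \<in> ?K. k j < z} = q - j" if "j < Suc q" for j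
  proof -
    have "{z \<in> ?K. k j < z} = k ` {j<..<Suc q}"
      using that by (auto simp: less)
    also have "card \<dots> = card {j<..<Suc q}"
      by (rule card_image[OF inj_on_subset[OF inj]]) auto
    finally show ?thesis by simp
  qed
  have rest: "?K - {k j} = (\<lambda>i. k (skip j i)) ` {..<q}" if "j < Suc q" for j
  proof -
    have "(\<lambda>i. k (skip j i)) ` {..<q} = k ` (skip j ` {..<q})" by (simp add: image_image)
    also have "skip j ` {..<q} = {..<Suc q} - {j}"
      using that by (subst skip_image) auto
    also have "k ` \<dots> = ?K - {k j}" using that by (auto simp: eq)
    finally show ?thesis ..
  qed
  have del: "mat_delete ?A q j = mat q q (\<lambda>(i, l). f i (k (skip j l)))" for j
    by (rule eq_matI) (auto simp: mat_delete_def skip_def)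
  have "row_minor (Suc q) f ?K =
      (\<Sum>j<Suc q. (-1) ^ (q - j) * f q (k j) * row_minor q f ((\<lambda>i. k (skip j i)) ` {..<q}))"
    unfolding row_minor.simps sum.reindex[OF inj] o_def
    by (rule sum.cong[OF refl]) (simp only: lessThan_iff card rest)
  also have "\<dots> = (\<Sum>j<Suc q. ?A $$ (q, j) * cofactor ?A q j)"
  proof (intro sum.cong refl)
    fix j assume j: "j \<in> {..<Suc q}"
    have "strict_mono_on {..<q} (\<lambda>i. k (skip j i))"
      by (rule strict_mono_onI) (use Suc.prems in \<open>auto simp: less skip_def\<close>)
    note IH = Suc.IH[OF this]
    have "(-1::'a) ^ (q + j) = (-1) ^ (q - j)"
      using j by (intro minus_one_power_cong) auto
    then show "(-1) ^ (q - j) * f q (k j) * row_minor q f ((\<lambda>i. k (skip j i)) ` {..<q}) =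
        ?A $$ (q, j) * cofactor ?A q j"
      using j by (simp add: IH cofactor_def del mult_ac)
  qed
  also have "\<dots> = det ?A"
    by (rule laplace_expansion_row[symmetric]) auto
  finally show ?case .
qed

text \<open>The number of inversions of the shuffle that lists \<open>K\<close> before
  \<open>S - K\<close>.\<close>

definition cross_card :: "nat set \<Rightarrow> nat set \<Rightarrow> nat" where
  "cross_card K S = card {(s, k). s \<in> S - K \<and> k \<in> K \<and> s < k}"

lemma cross_card_eq_sum:
  assumes "finite S" "K \<subseteq> S"
  shows "cross_card K S = (\<Sum>k\<in>K. card {s \<in> S - K. s < k})"
proof -
  have "{(s, k). s \<in> S - K \<and> k \<in> K \<and> s < k} = prod.swap ` (SIGMA k:K. {s \<in> S - K. s < k})"
    by (auto simp: image_iff)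
  then have "cross_card K S = card (SIGMA k:K. {s \<in> S - K. s < k})"
    by (simp add: cross_card_def card_image)
  also have "\<dots> = (\<Sum>k\<in>K. card {s \<in> S - K. s < k})"
    using assms by (intro card_SigmaI) (auto intro: finite_subset)
  finally show ?thesis .
qed

text \<open>All counts split at \<open>y\<close>. The multiple of 2 keeps the equation free of
  subtraction; only its parity matters, when the sign of pairing a row with \<open>y\<close> is
  compared with the Laplace sign of \<open>y\<close> in the minor.\<close>

lemma cross_card_insert:
  assumes "finite S" "K \<subseteq> S - {y}" "y \<in> S"
  shows "cross_card K (S - {y}) + card {z \<in> S. z < y} + 2 * card {z \<in> insert y K. y < z}
    = cross_card (insert y K) S + card K + card {z \<in> insert y K. y < z}"
proof -
  have yK: "y \<notin> K" using assms(2) by blast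
  have fin: "finite K" by (rule finite_subset[OF assms(2)]) (simp add: assms(1))
  have KS: "insert y K \<subseteq> S" using assms by blast
  have "cross_card (insert y K) S = (\<Sum>k\<in>insert y K. card {s \<in> S - insert y K. s < k})"
    by (rule cross_card_eq_sum[OF assms(1) KS])
  moreover have "cross_card K (S - {y}) = (\<Sum>k\<in>K. card {s \<in> S - {y} - K. s < k})"
    by (rule cross_card_eq_sum) (use assms in auto)
  moreover have "S - {y} - K = S - insert y K" by blast
  ultimately have "cross_card (insert y K) S
      = card {s \<in> S - insert y K. s < y} + cross_card K (S - {y})"
    using yK fin by simp
  moreover have "card {z \<in> S. z < y} = card {s \<in> S - insert y K. s < y} + card {z \<in> K. z < y}"
  proof -
    have "{z \<in> S. z < y} = {s \<in> S - insert y K. s < y} \<union> {z \<in> K. z < y}" using KS by blast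
    then show ?thesis using assms(1) fin by (simp add: card_Un_disjoint disjoint_iff)
  qed
  moreover have "card K = card {z \<in> K. z < y} + card {z \<in> insert y K. y < z}"
  proof -
    have "K = {z \<in> K. z < y} \<union> {z \<in> insert y K. y < z}"
      using yK by (auto simp: not_less le_less)
    moreover have "card ({z \<in> K. z < y} \<union> {z \<in> insert y K. y < z})
        = card {z \<in> K. z < y} + card {z \<in> insert y K. y < z}"
      using fin by (intro card_Un_disjoint) auto
    ultimately show ?thesis by simp
  qed
  ultimately show ?thesis by simp
qed

text \<open>The least remaining row can only be paired with an element of \<open>S\<close>, because
  its entries in the zero block vanish. Induction on the number \<open>q\<close> of remaining rows
  removes it together with its partner.\<close>

lemma set_pf_zero_block:
  fixes a :: "nat \<Rightarrow> nat \<Rightarrow> 'a::comm_ring_1"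
  assumes zero: "\<And>i j. i < n \<Longrightarrow> j < n \<Longrightarrow> a i j = 0"
    and "q \<le> n" "finite S" "S \<subseteq> {n..}"
  shows "set_pf a (q + h) ({n - q..<n} \<union> S) =
    (\<Sum>K\<in>{K. K \<subseteq> S \<and> card K = q}. (-1) ^ cross_card K S *
       row_minor q (\<lambda>i. a (n - Suc i)) K * set_pf a h (S - K))"
  using assms(2-4)
proof (induction q arbitrary: S)
  case 0
  have "{K. K \<subseteq> S \<and> card K = 0} = {{}}"
    using finite_subset[OF _ \<open>finite S\<close>] by auto
  then show ?case by (simp add: cross_card_def)
next
  case (Suc q)
  define r where "r = n - Suc q"
  define g where "g = (\<lambda>i. a (n - Suc i))"
  have r: "r < n" "n - q = Suc r" using Suc.prems by (auto simp: r_def)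
  have rS: "z \<ge> n" if "z \<in> S" for z using Suc.prems that by auto
  let ?R = "{r..<n} \<union> S"
  have Min: "Min ?R = r" using r rS Suc.prems by (intro Min_eqI) (auto dest: rS)
  have "set_pf a (Suc q + h) ?R = (\<Sum>y\<in>?R - {r}. (-1) ^ card {z \<in> ?R. r < z \<and> z < y} *
      a r y * set_pf a (q + h) (?R - {r, y}))"
    unfolding add_Suc set_pf.simps Min ..
  also have "\<dots> = (\<Sum>y\<in>S. (-1) ^ card {z \<in> ?R. r < z \<and> z < y} *
      a r y * set_pf a (q + h) (?R - {r, y}))"
    using Suc.prems r by (intro sum.mono_neutral_right) (auto simp: zero dest: rS)
  also have "\<dots> = (\<Sum>y\<in>S. \<Sum>K\<in>{K. K \<subseteq> S - {y} \<and> card K = q}.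
      (-1) ^ (q + card {z \<in> S. z < y} + cross_card K (S - {y})) *
       a r y * row_minor q g K * set_pf a h (S - insert y K))"
  proof (intro sum.cong refl)
    fix y assume y: "y \<in> S"
    have "{z \<in> ?R. r < z \<and> z < y} = {Suc r..<n} \<union> {z \<in> S. z < y}"
      using y r by (auto dest: rS)
    moreover have "card \<dots> = card {Suc r..<n} + card {z \<in> S. z < y}"
      using Suc.prems by (intro card_Un_disjoint) (auto dest: rS)
    \<comment> \<open>Between row \<open>r\<close> and column \<open>y\<close> lie the
      \<open>q\<close> other remaining rows; they account for the \<open>q\<close> in the
      exponent.\<close>
    ultimately have c: "card {z \<in> ?R. r < z \<and> z < y} = q + card {z \<in> S. z < y}"
      using Suc.prems by (simp add: r_def)
    have "?R - {r, y} = {n - q..<n} \<union> (S - {y})" using y r by (auto dest: rS)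
    moreover have "set_pf a (q + h) \<dots> = (\<Sum>K\<in>{K. K \<subseteq> S - {y} \<and> card K = q}.
        (-1) ^ cross_card K (S - {y}) * row_minor q g K * set_pf a h (S - {y} - K))"
      unfolding g_def using Suc.prems by (intro Suc.IH) auto
    moreover have "S - {y} - K = S - insert y K" for K by auto
    ultimately show "(-1) ^ card {z \<in> ?R. r < z \<and> z < y} * a r y * set_pf a (q + h) (?R - {r, y}) =
      (\<Sum>K\<in>{K. K \<subseteq> S - {y} \<and> card K = q}.
      (-1) ^ (q + card {z \<in> S. z < y} + cross_card K (S - {y})) *
       a r y * row_minor q g K * set_pf a h (S - insert y K))"
      unfolding c by (simp add: sum_distrib_left power_add mult_ac)
  qed
  also have "\<dots> = (\<Sum>(y, K)\<in>(SIGMA y:S. {K. K \<subseteq> S - {y} \<and> card K = q}).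
      (-1) ^ (q + card {z \<in> S. z < y} + cross_card K (S - {y})) *
       a r y * row_minor q g K * set_pf a h (S - insert y K))"
    using Suc.prems by (intro sum.Sigma) auto
  \<comment> \<open>Merges the partner \<open>y\<close> of row \<open>r\<close> with the columns of
    the other rows, keeping \<open>y\<close> as a mark. The marked column is the one used by the
    Laplace expansion along the new last row.\<close>
  also have "\<dots> = (\<Sum>(K, y)\<in>(SIGMA K:{K. K \<subseteq> S \<and> card K = Suc q}. K).
      (-1) ^ (cross_card K S + card {z \<in> K. y < z}) *
       a r y * row_minor q g (K - {y}) * set_pf a h (S - K))"
  proof (rule sum.reindex_bij_witness[where i = "\<lambda>(K, y). (y, K - {y})"
        and j = "\<lambda>(y, K). (insert y K, y)"], goal_cases)
    case (1 p)
    then obtain y K where p: "p = (y, K)" "y \<notin> K" by auto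
    then show ?case by simp
  next
    case (2 p)
    then obtain y K where p: "p = (y, K)" "y \<in> S" "K \<subseteq> S - {y}" "card K = q" by auto
    then have "finite K" "y \<notin> K" using finite_subset[OF _ \<open>finite S\<close>, of K] by auto
    then show ?case using p by auto
  next
    case (3 p)
    then obtain y K where p: "p = (K, y)" "y \<in> K" by auto
    then show ?case by (simp add: insert_absorb)
  next
    case (4 p)
    then obtain K y where p: "p = (K, y)" "y \<in> K" "K \<subseteq> S" "card K = Suc q" by auto
    have "card (K - {y}) = q" using p by simp
    then show ?case unfolding p(1) using p(2,3) by (simp add: subset_iff)
  next
    case (5 p)
    then obtain y K where p: "p = (y, K)" "y \<in> S" "K \<subseteq> S - {y}" "card K = q" by auto
    then have "y \<notin> K" by auto
    have "even (q + card {z \<in> S. z < y} + cross_card K (S - {y})) =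
        even (cross_card (insert y K) S + card {z \<in> insert y K. y < z})"
      using cross_card_insert[OF \<open>finite S\<close> p(3,2)] unfolding p(4) by presburger
    from minus_one_power_cong[OF this, where 'a = 'a]
    show ?case using p \<open>y \<notin> K\<close> by simp
  qed
  also have "\<dots> = (\<Sum>K\<in>{K. K \<subseteq> S \<and> card K = Suc q}. \<Sum>y\<in>K.
      (-1) ^ (cross_card K S + card {z \<in> K. y < z}) *
       a r y * row_minor q g (K - {y}) * set_pf a h (S - K))"
    using Suc.prems by (intro sum.Sigma[symmetric]) (auto intro: finite_subset)
  also have "\<dots> = (\<Sum>K\<in>{K. K \<subseteq> S \<and> card K = Suc q}. (-1) ^ cross_card K S *
       row_minor (Suc q) g K * set_pf a h (S - K))"
    by (intro sum.cong refl)
       (simp add: sum_distrib_left sum_distrib_right power_add mult_ac g_def r_def)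
  finally show ?case by (simp add: r_def g_def)
qed

section \<open>Minors and nonintersecting paths\<close>

text \<open>
  \<open>(i, l) \<in> X\<close> means that path \<open>i\<close>, which starts at position \<open>i\<close>, moves one position up at level \<open>l\<close>;
  levels are passed downwards, and \<open>path_pos X L i\<close> is the position after all levels above \<open>L\<close>.
\<close>

definition path_pos :: "(nat \<times> nat) set \<Rightarrow> nat \<Rightarrow> nat \<Rightarrow> nat" where
  "path_pos X L i = i + card {l. (i, l) \<in> X \<and> L < l}"

definition path_families :: "nat \<Rightarrow> nat \<Rightarrow> nat \<Rightarrow> (nat \<times> nat) set set" where
  "path_families n M L = {X. X \<subseteq> {..<n} \<times> {L<..M} \<and>
     (\<forall>L'\<ge>L. strict_mono_on {..<n} (path_pos X L'))}"

definition path_weight :: "(nat \<Rightarrow> nat \<Rightarrow> 'a::comm_ring_1) \<Rightarrow> (nat \<times> nat) set \<Rightarrow> 'a" where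
  "path_weight w X = (\<Prod>(i, l)\<in>X. w l (path_pos X l i))"

lemma finite_path_families: "finite (path_families n M L)"
  by (rule finite_subset[of _ "Pow ({..<n} \<times> {L<..M})"]) (auto simp: path_families_def)

lemma strict_mono_on_add_le:
  assumes "strict_mono_on {..<n} (k :: nat \<Rightarrow> nat)" "j + d < n"
  shows "k j + d \<le> k (j + d)"
  using assms(2)
proof (induction d)
  case (Suc d)
  then have "k (j + d) < k (j + Suc d)"
    by (intro strict_mono_onD[OF assms(1)]) auto
  then show ?case using Suc by simp
qed simp

text \<open>If a strictly increasing \<open>k\<close> is not the identity on the first
  \<open>n\<close> indices, it exceeds it somewhere and then also at \<open>n - 1\<close>; the last
  column is then zero.\<close>

lemma det_unit_columns:
  assumes k: "strict_mono_on {..<n} (k :: nat \<Rightarrow> nat)"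
  shows "det (mat n n (\<lambda>(i, j). if k j = i then 1 else 0 :: 'a::comm_ring_1)) =
    (if \<forall>i<n. k i = i then 1 else 0)"
proof (cases "\<forall>i<n. k i = i")
  case True
  then have "mat n n (\<lambda>(i, j). if k j = i then 1 else 0) = (1\<^sub>m n :: 'a mat)"
    by (intro eq_matI) auto
  then show ?thesis using True by (simp only: det_one) simp
next
  case False
  then obtain j where j: "j < n" "k j \<noteq> j" by auto
  have "k 0 + j \<le> k j" using strict_mono_on_add_le[OF k, of 0 j] j by simp
  moreover have "k j + (n - 1 - j) \<le> k (n - 1)"
    using strict_mono_on_add_le[OF k, of j "n - 1 - j"] j by simp
  ultimately have "k (n - 1) \<ge> n" using j by linarith
  then show ?thesis using False j
    by (subst laplace_expansion_column[where j = "n - 1"]) auto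
qed

text \<open>\<open>f L i k\<close> stands for the entry in row \<open>i\<close> and column
  \<open>k\<close> when exactly the levels above \<open>L\<close> are multiplied in. As
  \<open>w\<close> does not mention \<open>i\<close>, a column at level \<open>L\<close> is a
  combination of two columns at level \<open>Suc L\<close>.\<close>

context
  fixes f :: "nat \<Rightarrow> nat \<Rightarrow> nat \<Rightarrow> 'a::comm_ring_1" and w :: "nat \<Rightarrow> nat \<Rightarrow> 'a" and n M :: nat
  assumes f_base: "i < n \<Longrightarrow> f M i k = (if k = i then 1 else 0)"
    and f_step: "L < M \<Longrightarrow> f L i k =
      f (Suc L) i k + (if k = 0 then 0 else w (Suc L) (k - 1)) * f (Suc L) i (k - 1)"
begin

text \<open>Multilinearity in the columns; \<open>E\<close> collects the columns from which the
  shifted term is taken.\<close>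

lemma det_step:
  assumes "L < M"
  shows "det (mat n n (\<lambda>(i, j). f L i (k j))) =
    (\<Sum>E\<in>Pow {j. j < n \<and> k j \<noteq> 0}. (\<Prod>j\<in>E. w (Suc L) (k j - 1)) *
       det (mat n n (\<lambda>(i, j). f (Suc L) i (if j \<in> E then k j - 1 else k j))))"
proof -
  define v where "v j = (if k j = 0 then 0 else w (Suc L) (k j - 1))" for j
  define g where "g = f (Suc L)"
  let ?P = "{p. p permutes {0..<n}}"
  have "det (mat n n (\<lambda>(i, j). f L i (k j))) =
      (\<Sum>p\<in>?P. signof p * (\<Prod>j<n. v j * g (p j) (k j - 1) + g (p j) (k j)))"
    by (subst det_col[of _ n])
       (auto simp: f_step[OF assms] v_def g_def algebra_simps permutes_in_image
             intro!: sum.cong prod.cong)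
  also have "\<dots> = (\<Sum>p\<in>?P. \<Sum>E\<in>Pow {..<n}. prod v E *
      (signof p * (\<Prod>j<n. g (p j) (if j \<in> E then k j - 1 else k j))))"
  proof (intro sum.cong refl)
    fix p
    have "(\<Prod>j\<in>E. v j * g (p j) (k j - 1)) * (\<Prod>j\<in>{..<n} - E. g (p j) (k j)) =
        prod v E * (\<Prod>j<n. g (p j) (if j \<in> E then k j - 1 else k j))"
      if "E \<subseteq> {..<n}" for E
      using that
      by (subst prod.subset_diff[OF that finite_lessThan])
         (simp add: prod.distrib mult_ac)
    then show "signof p * (\<Prod>j<n. v j * g (p j) (k j - 1) + g (p j) (k j)) =
      (\<Sum>E\<in>Pow {..<n}. prod v E *
        (signof p * (\<Prod>j<n. g (p j) (if j \<in> E then k j - 1 else k j))))"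
      by (simp add: prod_add sum_distrib_left mult_ac)
  qed
  also have "\<dots> = (\<Sum>E\<in>Pow {..<n}. prod v E *
      (\<Sum>p\<in>?P. signof p * (\<Prod>j<n. g (p j) (if j \<in> E then k j - 1 else k j))))"
    by (subst sum.swap) (simp add: sum_distrib_left)
  also have "\<dots> = (\<Sum>E\<in>Pow {..<n}. prod v E *
      det (mat n n (\<lambda>(i, j). g i (if j \<in> E then k j - 1 else k j))))"
    by (intro sum.cong refl arg_cong2[where f = "(*)"])
       (subst det_col[of _ n], auto simp: permutes_in_image intro!: sum.cong prod.cong)
  \<comment> \<open>The multiplier vanishes at position 0. Excluding these columns from
    \<open>E\<close> makes \<open>k j - 1\<close> a true predecessor, to be read as the position
    before a step.\<close>
  also have "\<dots> = (\<Sum>E\<in>Pow {j. j < n \<and> k j \<noteq> 0}. prod v E *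
      det (mat n n (\<lambda>(i, j). g i (if j \<in> E then k j - 1 else k j))))"
  proof (rule sum.mono_neutral_right)
    show "\<forall>E\<in>Pow {..<n} - Pow {j. j < n \<and> k j \<noteq> 0}. prod v E *
        det (mat n n (\<lambda>(i, j). g i (if j \<in> E then k j - 1 else k j))) = 0"
    proof
      fix E assume E: "E \<in> Pow {..<n} - Pow {j. j < n \<and> k j \<noteq> 0}"
      then obtain j where j: "j \<in> E" "k j = 0" by auto
      have "finite E" using E by (auto intro: finite_subset)
      moreover have "v j = 0" using j by (simp add: v_def)
      ultimately have "prod v E = 0" using j by (intro prod_zero) auto
      then show "prod v E * det (mat n n (\<lambda>(i, j). g i (if j \<in> E then k j - 1 else k j))) = 0"
        by simp
    qed
  qed auto
  also have "\<dots> = (\<Sum>E\<in>Pow {j. j < n \<and> k j \<noteq> 0}. (\<Prod>j\<in>E. w (Suc L) (k j - 1)) *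
       det (mat n n (\<lambda>(i, j). g i (if j \<in> E then k j - 1 else k j))))"
    by (intro sum.cong refl arg_cong2[where f = "(*)"] prod.cong) (auto simp: v_def)
  finally show ?thesis unfolding g_def .
qed

text \<open>For weakly increasing indices a failure of strictness is a repeated column. This takes
  the place of the tail-swapping involution on intersecting paths.\<close>

lemma det_eq_0_if_not_strict_mono:
  assumes "\<And>i j. i < j \<Longrightarrow> j < n \<Longrightarrow> k i \<le> (k j :: nat)" "\<not> strict_mono_on {..<n} k"
  shows "det (mat n n (\<lambda>(i, j). f L i (k j))) = 0"
proof -
  from assms(2) obtain i j where ij: "i < j" "j < n" "\<not> k i < k j"
    unfolding strict_mono_on_def by auto
  then have "k i = k j" using assms(1)[of i j] by simp
  then show ?thesis using ij
    by (intro det_identical_columns[of _ n i j]) auto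
qed

lemma path_pos_insert_level:
  assumes "X \<subseteq> {..<n} \<times> {Suc L<..M}" "E \<subseteq> {..<n}"
  shows "L < L' \<Longrightarrow> path_pos (X \<union> E \<times> {Suc L}) L' = path_pos X L'"
    "path_pos (X \<union> E \<times> {Suc L}) L i = path_pos X (Suc L) i + (if i \<in> E then 1 else 0)"
proof -
  show "path_pos (X \<union> E \<times> {Suc L}) L' = path_pos X L'" if "L < L'"
    using that by (auto simp: path_pos_def fun_eq_iff intro!: arg_cong[of _ _ card])
  have fin: "finite {l. (i, l) \<in> X \<and> Suc L < l}"
    by (rule finite_subset[of _ "{..M}"]) (use assms in auto)
  have "{l. (i, l) \<in> X \<union> E \<times> {Suc L} \<and> L < l} =
      {l. (i, l) \<in> X \<and> Suc L < l} \<union> (if i \<in> E then {Suc L} else {})"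
    using assms by (auto simp: subset_iff)
  then show "path_pos (X \<union> E \<times> {Suc L}) L i = path_pos X (Suc L) i + (if i \<in> E then 1 else 0)"
    using fin by (auto simp: path_pos_def)
qed

lemma path_weight_insert_level:
  assumes X: "X \<subseteq> {..<n} \<times> {Suc L<..M}" and E: "E \<subseteq> {..<n}"
  shows "path_weight w (X \<union> E \<times> {Suc L}) =
    (\<Prod>i\<in>E. w (Suc L) (path_pos X (Suc L) i)) * path_weight w X"
proof -
  have fin: "finite X" "finite E"
    using finite_subset[OF X] finite_subset[OF E] by auto
  have "path_weight w (X \<union> E \<times> {Suc L}) =
      (\<Prod>(i, l)\<in>X. w l (path_pos (X \<union> E \<times> {Suc L}) l i)) *
      (\<Prod>(i, l)\<in>E \<times> {Suc L}. w l (path_pos (X \<union> E \<times> {Suc L}) l i))"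
    unfolding path_weight_def using fin X by (intro prod.union_disjoint) auto
  also have "(\<Prod>(i, l)\<in>X. w l (path_pos (X \<union> E \<times> {Suc L}) l i)) = path_weight w X"
    unfolding path_weight_def
  proof (intro prod.cong refl, clarify)
    fix i l assume "(i, l) \<in> X"
    then have "L < l" using X by auto
    then show "w l (path_pos (X \<union> E \<times> {Suc L}) l i) = w l (path_pos X l i)"
      by (simp add: path_pos_insert_level(1)[OF X E])
  qed
  also have "(\<Prod>(i, l)\<in>E \<times> {Suc L}. w l (path_pos (X \<union> E \<times> {Suc L}) l i)) =
      (\<Prod>i\<in>E. w (Suc L) (path_pos X (Suc L) i))"
    by (subst prod.cartesian_product[symmetric]) (simp add: path_pos_insert_level(1)[OF X E])
  finally show ?thesis by (simp add: mult.commute)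
qed

text \<open>A Lindstroem-Gessel-Viennot formula, by induction from the top level downwards.
  Multilinearity peels off the lowest level, at which every path moves by at most one.\<close>

lemma det_eq_sum_path_families:
  assumes "L \<le> M" "strict_mono_on {..<n} k"
  shows "det (mat n n (\<lambda>(i, j). f L i (k j))) =
    (\<Sum>X\<in>{X \<in> path_families n M L. \<forall>i<n. path_pos X L i = k i}. path_weight w X)"
  using assms
proof (induction L arbitrary: k rule: inc_induct)
  case base
  have "path_families n M M = {{}}"
    by (auto simp: path_families_def path_pos_def strict_mono_on_def)
  then have "{X \<in> path_families n M M. \<forall>i<n. path_pos X M i = k i} =
      (if \<forall>i<n. k i = i then {{}} else {})"
    by (auto simp: path_pos_def)
  moreover have "mat n n (\<lambda>(i, j). f M i (k j)) = mat n n (\<lambda>(i, j). if k j = i then 1 else 0)"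
    by (intro eq_matI) (auto simp: f_base)
  ultimately show ?case
    by (simp add: det_unit_columns[OF base] path_weight_def)
next
  case (step L)
  define kE where "kE E j = (if j \<in> E then k j - 1 else k j)" for E j
  let ?N = "{j. j < n \<and> k j \<noteq> 0}"
  have k_less: "k i < k j" if "i < j" "j < n" for i j
    using strict_mono_onD[OF step.prems, of i j] that by simp
  have "det (mat n n (\<lambda>(i, j). f L i (k j))) =
    (\<Sum>E\<in>Pow ?N. (\<Prod>j\<in>E. w (Suc L) (k j - 1)) * det (mat n n (\<lambda>(i, j). f (Suc L) i (kE E j))))"
    unfolding kE_def using step.hyps by (intro det_step) simp
  also have "\<dots> = (\<Sum>E\<in>Pow ?N. \<Sum>X\<in>{X \<in> path_families n M (Suc L). \<forall>i<n. path_pos X (Suc L) i = kE E i}.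
      (\<Prod>j\<in>E. w (Suc L) (k j - 1)) * path_weight w X)"
  proof (intro sum.cong refl)
    fix E
    have "det (mat n n (\<lambda>(i, j). f (Suc L) i (kE E j))) =
        (\<Sum>X\<in>{X \<in> path_families n M (Suc L). \<forall>i<n. path_pos X (Suc L) i = kE E i}. path_weight w X)"
    proof (cases "strict_mono_on {..<n} (kE E)")
      case True
      then show ?thesis by (rule step.IH)
    next
      case False
      \<comment> \<open>In a collision both sides vanish: families in the sum keep their paths at
        distinct positions, and the determinant has two equal columns.\<close>
      have "\<not> (\<forall>i<n. path_pos X (Suc L) i = kE E i)" if "X \<in> path_families n M (Suc L)" for X
      proof
        assume eq: "\<forall>i<n. path_pos X (Suc L) i = kE E i"
        have "strict_mono_on {..<n} (path_pos X (Suc L))" using that by (simp add: path_families_def)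
        then have "strict_mono_on {..<n} (kE E)" using eq by (simp add: strict_mono_on_def)
        then show False using False by simp
      qed
      then have empty: "{X \<in> path_families n M (Suc L). \<forall>i<n. path_pos X (Suc L) i = kE E i} = {}"
        by blast
      have "kE E i \<le> kE E j" if "i < j" "j < n" for i j
        using k_less[OF that] by (auto simp: kE_def)
      then have "det (mat n n (\<lambda>(i, j). f (Suc L) i (kE E j))) = 0"
        using False by (rule det_eq_0_if_not_strict_mono)
      then show ?thesis by (simp only: empty sum.empty)
    qed
    then show "(\<Prod>j\<in>E. w (Suc L) (k j - 1)) * det (mat n n (\<lambda>(i, j). f (Suc L) i (kE E j))) =
      (\<Sum>X\<in>{X \<in> path_families n M (Suc L). \<forall>i<n. path_pos X (Suc L) i = kE E i}.
      (\<Prod>j\<in>E. w (Suc L) (k j - 1)) * path_weight w X)"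
      by (simp only: sum_distrib_left)
  qed
  also have "\<dots> = (\<Sum>(E, X)\<in>(SIGMA E:Pow ?N.
      {X \<in> path_families n M (Suc L). \<forall>i<n. path_pos X (Suc L) i = kE E i}).
      (\<Prod>j\<in>E. w (Suc L) (k j - 1)) * path_weight w X)"
    by (rule sum.Sigma) (auto simp: finite_path_families)
  also have "\<dots> = (\<Sum>X\<in>{X \<in> path_families n M L. \<forall>i<n. path_pos X L i = k i}. path_weight w X)"
  \<comment> \<open>A family splits into the set of paths moving at level \<open>Suc L\<close> and
    the steps at higher levels.\<close>
  proof (rule sum.reindex_bij_witness[where j = "\<lambda>(E, X). X \<union> E \<times> {Suc L}"
        and i = "\<lambda>X. ({i. (i, Suc L) \<in> X}, X - UNIV \<times> {Suc L})"], goal_cases)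
    case (1 p)
    then obtain E X where p: "p = (E, X)" "X \<subseteq> {..<n} \<times> {Suc L<..M}"
      by (auto simp: path_families_def)
    then have "(i, Suc L) \<notin> X" for i by auto
    then show ?case unfolding p(1) by auto
  next
    case (2 p)
    then obtain E X where p: "p = (E, X)" "E \<subseteq> ?N" "X \<subseteq> {..<n} \<times> {Suc L<..M}"
      "\<forall>L'\<ge>Suc L. strict_mono_on {..<n} (path_pos X L')"
      "\<forall>i<n. path_pos X (Suc L) i = kE E i"
      by (auto simp: path_families_def)
    have E: "E \<subseteq> {..<n}" using p(2) by auto
    let ?X = "X \<union> E \<times> {Suc L}"
    note pp = path_pos_insert_level[OF p(3) E]
    have eq: "path_pos ?X L i = k i" if "i < n" for i
      using that p(2,5) by (auto simp: pp(2) kE_def)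
    have "strict_mono_on {..<n} (path_pos ?X L')" if "L' \<ge> L" for L'
    proof (cases "L' = L")
      case True
      then show ?thesis using step.prems eq by (simp add: strict_mono_on_def)
    next
      case False
      then have "L < L'" using that by simp
      then show ?thesis using p(4) by (simp add: pp(1))
    qed
    moreover have "?X \<subseteq> {..<n} \<times> {L<..M}"
      using p(3) E step.hyps by auto
    ultimately show ?case unfolding p(1) using eq by (simp add: path_families_def)
  next
    case (3 X)
    show ?case by auto
  next
    case (4 X')
    define E where "E = {i. (i, Suc L) \<in> X'}"
    define X where "X = X' - UNIV \<times> {Suc L}"
    have X': "X' = X \<union> E \<times> {Suc L}" by (auto simp: E_def X_def)
    have fam: "X' \<subseteq> {..<n} \<times> {L<..M}" "\<And>L'. L' \<ge> L \<Longrightarrow> strict_mono_on {..<n} (path_pos X' L')"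
      "\<And>i. i < n \<Longrightarrow> path_pos X' L i = k i"
      using 4 by (auto simp: path_families_def)
    have X: "X \<subseteq> {..<n} \<times> {Suc L<..M}"
    proof
      fix p assume "p \<in> X"
      then obtain i l where "p = (i, l)" "(i, l) \<in> X'" "l \<noteq> Suc L" by (cases p) (auto simp: X_def)
      then show "p \<in> {..<n} \<times> {Suc L<..M}" using fam(1) by auto
    qed
    have E: "E \<subseteq> {..<n}" using fam(1) by (auto simp: E_def)
    note pp = path_pos_insert_level[OF X E, folded X']
    have "E \<subseteq> ?N"
    proof
      fix i assume "i \<in> E"
      then show "i \<in> ?N" using pp(2)[of i] fam(3)[of i] E by auto
    qed
    moreover have "path_pos X (Suc L) i = kE E i" if "i < n" for i
      using pp(2)[of i] fam(3)[OF that] by (auto simp: kE_def split: if_splits)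
    moreover have "strict_mono_on {..<n} (path_pos X L')" if "L' \<ge> Suc L" for L'
      using fam(2)[of L'] pp(1)[of L'] that by simp
    ultimately have "(E, X) \<in> (SIGMA E:Pow ?N.
      {X \<in> path_families n M (Suc L). \<forall>i<n. path_pos X (Suc L) i = kE E i})"
      using X by (simp add: path_families_def)
    then show ?case by (simp add: E_def X_def)
  next
    case (5 p)
    then obtain E X where p: "p = (E, X)" "E \<subseteq> ?N" "X \<subseteq> {..<n} \<times> {Suc L<..M}"
      "\<forall>i<n. path_pos X (Suc L) i = kE E i"
      by (auto simp: path_families_def)
    have E: "E \<subseteq> {..<n}" using p(2) by auto
    have "(\<Prod>i\<in>E. w (Suc L) (path_pos X (Suc L) i)) = (\<Prod>i\<in>E. w (Suc L) (k i - 1))"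
      using p(4) E by (intro prod.cong refl) (auto simp: kE_def)
    then show ?case unfolding p(1) by (simp add: path_weight_insert_level[OF p(3) E])
  qed
  finally show ?case .
qed

end

text \<open>
  The weight of a step depends only on the level \<open>l\<close> and the position \<open>p\<close> before the step, not on the
  path: position \<open>l - m\<close> is available above level \<open>l\<close> only as the starting point of path \<open>l - m\<close>.
\<close>

definition edge_weight ::
  "nat \<Rightarrow> nat \<Rightarrow> (nat \<Rightarrow> 'a::comm_ring_1) \<Rightarrow> (nat \<Rightarrow> 'a) \<Rightarrow> nat \<Rightarrow> nat \<Rightarrow> 'a" where
  "edge_weight n m t x l p =
     (if p + m < l then 0 else if p + m = l then T_prod n m t l * x l else t l * x l)"

definition row_weight ::
  "nat \<Rightarrow> nat \<Rightarrow> (nat \<Rightarrow> 'a::comm_ring_1) \<Rightarrow> (nat \<Rightarrow> 'a) \<Rightarrow> nat \<Rightarrow> nat \<Rightarrow> 'a" where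
  "row_weight n m t x i l = (if l = i + m then T_prod n m t l * x l else t l * x l)"

text \<open>The coefficient of \<open>z ^ k\<close> in the polynomial of row \<open>i\<close> when
  only the factors of levels above \<open>L\<close> are kept; \<open>L = 0\<close> gives the row of
  \<open>B\<close>.\<close>

definition row_coeff ::
  "nat \<Rightarrow> nat \<Rightarrow> (nat \<Rightarrow> 'a::comm_ring_1) \<Rightarrow> (nat \<Rightarrow> 'a) \<Rightarrow> nat \<Rightarrow> nat \<Rightarrow> nat \<Rightarrow> 'a" where
  "row_coeff n m t x L i k =
     (\<Sum>S\<in>{S. S \<subseteq> {L<..i + m} \<and> i + card S = k}. \<Prod>l\<in>S. row_weight n m t x i l)"

lemma row_coeff_trivial:
  "i + m \<le> L \<Longrightarrow> row_coeff n m t x L i k = (if k = i then 1 else 0)"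
proof -
  assume "i + m \<le> L"
  then have "{S. S \<subseteq> {L<..i + m} \<and> i + card S = k} = (if k = i then {{}} else {})" by auto
  then show ?thesis by (simp add: row_coeff_def)
qed

text \<open>The subsets split by whether they contain the smallest level \<open>Suc L\<close>. In a
  term that does, the position \<open>k - 1\<close> before the step is \<open>i\<close> plus the
  number of higher levels used. It equals \<open>i\<close> if \<open>Suc L = i + m\<close>; if
  \<open>Suc L < i + m\<close>, then \<open>k - 1 + m\<close> exceeds \<open>Suc L\<close>. Either
  way \<open>edge_weight\<close> gives the factor of row \<open>i\<close>.\<close>

lemma row_coeff_step:
  "row_coeff n m t x L i k = row_coeff n m t x (Suc L) i k +
     (if k = 0 then 0 else edge_weight n m t x (Suc L) (k - 1)) * row_coeff n m t x (Suc L) i (k - 1)"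
proof (cases "i + m \<le> L")
  case True
  \<comment> \<open>Row \<open>i\<close> has no factor at level \<open>Suc L\<close>. Its only
    nonzero coefficient is at position \<open>i\<close>, where \<open>edge_weight\<close> is
    0.\<close>
  then show ?thesis by (simp add: row_coeff_trivial edge_weight_def)
next
  case False
  let ?y = "row_weight n m t x i"
  define F where "F k = {S. S \<subseteq> {Suc L<..i + m} \<and> i + card S = k}" for k
  define G where "G = {S. S \<subseteq> {Suc L<..i + m} \<and> Suc (i + card S) = k}"
  have fin: "finite S" if "S \<subseteq> {Suc L<..i + m}" for S
    using that finite_subset by blast
  have finF: "finite (F k)" "finite G" for k
    by (rule finite_subset[of _ "Pow {Suc L<..i + m}"]; auto simp: F_def G_def)+
  have ins: "{L<..i + m} = insert (Suc L) {Suc L<..i + m}" using False by auto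
  then have split: "{S. S \<subseteq> {L<..i + m} \<and> i + card S = k} = F k \<union> insert (Suc L) ` G"
  proof (intro equalityI subsetI, goal_cases)
    case (1 S)
    show ?case
    proof (cases "Suc L \<in> S")
      case True
      then have S: "S = insert (Suc L) (S - {Suc L})" by auto
      have sub: "S - {Suc L} \<subseteq> {Suc L<..i + m}" using 1 unfolding ins by blast
      have "card S = Suc (card (S - {Suc L}))"
        using card_insert_disjoint[OF fin[OF sub], of "Suc L"] S by simp
      then have "S - {Suc L} \<in> G" using 1 sub by (simp add: G_def)
      then show ?thesis using S by blast
    next
      case False
      then have "S \<subseteq> {Suc L<..i + m}" using 1 unfolding ins by blast
      then show ?thesis using 1 by (simp add: F_def)
    qed
  next
    case (2 S)
    then consider "S \<in> F k" | S' where "S = insert (Suc L) S'" "S' \<in> G" by blast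
    then show ?case
    proof cases
      case 1
      then show ?thesis by (auto simp: F_def)
    next
      case (2 S')
      then have "Suc L \<notin> S'" "finite S'" using fin by (auto simp: G_def)
      then show ?thesis using 2 False by (auto simp: G_def)
    qed
  qed
  have inj: "inj_on (insert (Suc L)) G"
  proof (rule inj_onI)
    fix S S' assume "S \<in> G" "S' \<in> G" and eq: "insert (Suc L) S = insert (Suc L) S'"
    then have "Suc L \<notin> S" "Suc L \<notin> S'" by (auto simp: G_def)
    then show "S = S'" using eq by (simp add: insert_ident)
  qed
  have "row_coeff n m t x L i k = (\<Sum>S\<in>F k. prod ?y S) + (\<Sum>S\<in>G. prod ?y (insert (Suc L) S))"
    unfolding row_coeff_def split
    by (subst sum.union_disjoint) (use finF inj in \<open>auto simp: F_def sum.reindex\<close>)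
  also have "(\<Sum>S\<in>F k. prod ?y S) = row_coeff n m t x (Suc L) i k"
    by (simp add: row_coeff_def F_def)
  also have "(\<Sum>S\<in>G. prod ?y (insert (Suc L) S)) =
      (\<Sum>S\<in>G. edge_weight n m t x (Suc L) (k - 1) * prod ?y S)"
  proof (rule sum.cong[OF refl])
    fix S assume "S \<in> G"
    then have S: "S \<subseteq> {Suc L<..i + m}" "k - 1 = i + card S" by (auto simp: G_def)
    have "prod ?y (insert (Suc L) S) = ?y (Suc L) * prod ?y S"
      using S fin[OF S(1)] by (subst prod.insert) auto
    moreover have "?y (Suc L) = edge_weight n m t x (Suc L) (k - 1)"
    proof (cases "Suc L = i + m")
      case True
      then have "S = {}" using S by auto
      then show ?thesis using True S by (simp add: row_weight_def edge_weight_def)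
    next
      case neq: False
      then show ?thesis using False S by (simp add: row_weight_def edge_weight_def)
    qed
    ultimately show "prod ?y (insert (Suc L) S) = edge_weight n m t x (Suc L) (k - 1) * prod ?y S"
      by simp
  qed
  also have "\<dots> = (if k = 0 then 0 else edge_weight n m t x (Suc L) (k - 1)) *
      row_coeff n m t x (Suc L) i (k - 1)"
  proof (cases "k = 0")
    case True
    then have "G = {}" by (auto simp: G_def)
    then show ?thesis using True by simp
  next
    case False
    then have "G = {S. S \<subseteq> {Suc L<..i + m} \<and> i + card S = k - 1}" by (auto simp: G_def)
    then show ?thesis using False by (simp add: row_coeff_def sum_distrib_left)
  qed
  finally show ?thesis .
qed

lemma B_mat_eq_row_coeff:
  assumes "i < n" "k < n + N"
  shows "B_mat n m N t x $$ (i, k) = row_coeff n m t x 0 i k"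
proof -
  have "{S. S \<subseteq> {1..i + m} \<and> int (card S) = int k - int i} =
      {S. S \<subseteq> {0<..i + m} \<and> i + card S = k}"
    by (auto simp: atLeastSucAtMost_greaterThanAtMost[symmetric])
  then show ?thesis using assms
    by (simp add: B_mat_def elem_sym_def row_coeff_def)
       (auto simp: row_weight_def intro!: sum.cong prod.cong)
qed

section \<open>Minors of \<open>B\<close> as sums over path families\<close>

definition bounded_families :: "nat \<Rightarrow> nat \<Rightarrow> (nat \<times> nat) set set" where
  "bounded_families n m = {X \<in> path_families n (n + m) 0. \<forall>(i, l)\<in>X. l \<le> i + m}"

text \<open>Some path \<open>i\<close> uses a level above \<open>i + m\<close>. Its first step, at
  its highest level, starts from position \<open>i\<close>, where that level has weight 0.\<close>

lemma path_weight_unbounded: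
  assumes X: "X \<in> path_families n (n + m) 0" "X \<notin> bounded_families n m"
  shows "path_weight (edge_weight n m t x) X = 0"
proof -
  obtain i l0 where i: "(i, l0) \<in> X" "i + m < l0"
    using X by (auto simp: bounded_families_def not_le)
  have sub: "X \<subseteq> {..<n} \<times> {0<..n + m}" using X by (simp add: path_families_def)
  have fin: "finite {l. (i, l) \<in> X}"
    by (rule finite_subset[of _ "{0<..n + m}"]) (use sub in auto)
  define l where "l = Max {l. (i, l) \<in> X}"
  have l: "(i, l) \<in> X" unfolding l_def using Max_in[OF fin] i by auto
  have max: "l' \<le> l" if "(i, l') \<in> X" for l' unfolding l_def using Max_ge[OF fin] that by simp
  have "i + m < l" using i max[of l0] by simp
  moreover have "{l'. (i, l') \<in> X \<and> l < l'} = {}" using max by (auto simp: not_less)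
  then have "path_pos X l i = i" unfolding path_pos_def by (simp only: card.empty)
  ultimately have "edge_weight n m t x l (path_pos X l i) = 0"
    by (simp add: edge_weight_def)
  moreover have "finite X" using finite_subset[OF sub] by simp
  ultimately show ?thesis unfolding path_weight_def using l
    by (intro prod_zero bexI[of _ "(i, l)"]) simp_all
qed

lemma strict_mono_on_image_eq:
  assumes "strict_mono_on {..<n} (f :: nat \<Rightarrow> nat)" "strict_mono_on {..<n} g"
    and eq: "f ` {..<n} = g ` {..<n}" and "i < n"
  shows "f i = g i"
  using \<open>i < n\<close>
proof (induction i rule: less_induct)
  case (less i)
  have aux: "g i \<le> f i" if "strict_mono_on {..<n} (f :: nat \<Rightarrow> nat)" "strict_mono_on {..<n} g"
    "f ` {..<n} = g ` {..<n}" "\<And>j. j < i \<Longrightarrow> f j = g j" for f g :: "nat \<Rightarrow> nat"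
  proof -
    have "f i \<in> g ` {..<n}" using that(3) less.prems by auto
    then obtain j where j: "j < n" "f i = g j" by auto
    have "\<not> j < i"
      using that(4)[of j] j strict_mono_onD[OF that(1), of j i] less.prems by auto
    then show ?thesis
      using j less.prems strict_mono_onD[OF that(2), of i j] by (cases "i = j") auto
  qed
  have "g i \<le> f i" using less assms by (intro aux) auto
  moreover have "f i \<le> g i" using less assms by (intro aux) auto
  ultimately show ?case by simp
qed

text \<open>The top level \<open>n + m\<close> suffices, since row \<open>i < n\<close> has no
  factor beyond level \<open>i + m\<close>. End positions are compared as sets because a minor is
  selected by a set of columns.\<close>

lemma det_B_minor:
  assumes k: "strict_mono_on {..<n} k"
  shows "det (mat n n (\<lambda>(i, j). row_coeff n m t x 0 i (k j))) =
    (\<Sum>X\<in>{X \<in> bounded_families n m. path_pos X 0 ` {..<n} = k ` {..<n}}.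
       path_weight (edge_weight n m t x) X)"
proof -
  have "det (mat n n (\<lambda>(i, j). row_coeff n m t x 0 i (k j))) =
    (\<Sum>X\<in>{X \<in> path_families n (n + m) 0. \<forall>i<n. path_pos X 0 i = k i}.
       path_weight (edge_weight n m t x) X)"
    by (rule det_eq_sum_path_families[of n "row_coeff n m t x" "n + m" "edge_weight n m t x",
          OF row_coeff_trivial row_coeff_step le0 k]) simp
  also have "\<dots> = (\<Sum>X\<in>{X \<in> bounded_families n m. path_pos X 0 ` {..<n} = k ` {..<n}}.
       path_weight (edge_weight n m t x) X)"
  proof (rule sum.mono_neutral_right)
    show "finite {X \<in> path_families n (n + m) 0. \<forall>i<n. path_pos X 0 i = k i}"
      by (simp add: finite_path_families)
    have iff: "path_pos X 0 ` {..<n} = k ` {..<n} \<longleftrightarrow> (\<forall>i<n. path_pos X 0 i = k i)"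
      if "X \<in> path_families n (n + m) 0" for X
    proof -
      have "strict_mono_on {..<n} (path_pos X 0)" using that by (simp add: path_families_def)
      from strict_mono_on_image_eq[OF this k] show ?thesis by (auto intro: image_cong)
    qed
    show "{X \<in> bounded_families n m. path_pos X 0 ` {..<n} = k ` {..<n}} \<subseteq>
        {X \<in> path_families n (n + m) 0. \<forall>i<n. path_pos X 0 i = k i}"
      using iff by (auto simp: bounded_families_def)
    show "\<forall>X\<in>{X \<in> path_families n (n + m) 0. \<forall>i<n. path_pos X 0 i = k i} -
        {X \<in> bounded_families n m. path_pos X 0 ` {..<n} = k ` {..<n}}.
        path_weight (edge_weight n m t x) X = 0"
      using iff by (auto intro: path_weight_unbounded)
  qed
  finally show ?thesis .
qed

section \<open>Path families and column-strict plane partitions\<close>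

lemma downward_closed_eq_atLeastAtMost:
  fixes P :: "nat set"
  assumes "finite P" "0 \<notin> P" "\<And>p q. 1 \<le> p \<Longrightarrow> p \<le> q \<Longrightarrow> q \<in> P \<Longrightarrow> p \<in> P"
  shows "P = {1..card P}"
proof (cases "P = {}")
  case False
  have "P = {1..Max P}"
  proof (intro equalityI subsetI)
    fix p assume "p \<in> P"
    then show "p \<in> {1..Max P}" using assms(1,2) by (cases "p = 0") auto
  next
    fix p assume "p \<in> {1..Max P}"
    then show "p \<in> P" using assms(3)[of p "Max P"] Max_in[OF assms(1) False] by auto
  qed
  then have "card P = card {1..Max P}" by (rule arg_cong)
  then have "card P = Max P" by simp
  with \<open>P = {1..Max P}\<close> show ?thesis by simp
qed simp

lemma CC_nonzeroD:
  assumes "c \<in> CC n m" "c p j \<noteq> 0"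
  shows "1 \<le> p" "1 \<le> j" "c p j + p \<le> n + m" "c p j + j \<le> n + m"
  using CC_bound[OF assms] by auto

lemma CC_row_mono:
  assumes "c \<in> CC n m" "1 \<le> i" "i \<le> j"
  shows "c p j \<le> c p i"
  using assms(3)
proof (induction j rule: dec_induct)
  case (step k)
  then have "1 \<le> k" using assms(2) by simp
  have "c p (Suc k) \<le> c p k"
  proof (cases "p = 0")
    case True
    then show ?thesis using assms(1) by (simp add: CC_def plane_partition_def)
  next
    case False
    then show ?thesis using assms(1) \<open>1 \<le> k\<close> by (simp add: CC_def plane_partition_def)
  qed
  then show ?case using step.IH by simp
qed simp

lemma CC_col_mono:
  assumes "c \<in> CC n m" "1 \<le> p" "p \<le> q"
  shows "c q j \<le> c p j"
  using assms(3)
proof (induction q rule: dec_induct)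
  case (step k)
  then have "1 \<le> k" using assms(2) by simp
  have "c (Suc k) j \<le> c k j"
  proof (cases "j = 0")
    case True
    then show ?thesis using assms(1) by (simp add: CC_def plane_partition_def)
  next
    case False
    then show ?thesis using assms(1) \<open>1 \<le> k\<close> by (simp add: CC_def plane_partition_def)
  qed
  then show ?case using step.IH by simp
qed simp

lemma CC_col_strict:
  assumes c: "c \<in> CC n m" and "1 \<le> p" "p < q" "c q j \<noteq> 0"
  shows "c q j < c p j"
proof -
  obtain q' where q: "q = Suc q'" "p \<le> q'" using assms(3) by (cases q) auto
  have "c (Suc q') j < c q' j"
    using c assms(2,4) q CC_nonzeroD(2)[OF c assms(4)] by (simp add: CC_def)
  also have "\<dots> \<le> c p j" by (rule CC_col_mono[OF c assms(2) q(2)])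
  finally show ?thesis by (simp add: q)
qed

lemma CC_col_le:
  assumes c: "c \<in> CC n m" and nz: "c p j \<noteq> 0"
  shows "j \<le> n"
proof -
  let ?J = "{j. \<exists>i. c i j \<noteq> 0}"
  have "?J \<subseteq> {..n + m}"
  proof
    fix j assume "j \<in> ?J"
    then obtain i where "c i j \<noteq> 0" by auto
    from CC_nonzeroD(4)[OF c this] show "j \<in> {..n + m}" by simp
  qed
  then have fin: "finite ?J" by (rule finite_subset) simp
  have "{1..j} \<subseteq> ?J"
  proof
    fix i assume "i \<in> {1..j}"
    then have "c p j \<le> c p i" by (intro CC_row_mono[OF c]) auto
    then show "i \<in> ?J" using nz by (intro CollectI exI[of _ p]) auto
  qed
  from card_mono[OF fin this] have "j \<le> card ?J" by simp
  also have "\<dots> \<le> n" using c by (simp add: CC_def)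
  finally show ?thesis .
qed

lemma finite_col_ge:
  assumes "c \<in> CC n m" "1 \<le> L"
  shows "finite {p. L \<le> c p j}"
proof (rule finite_subset)
  show "{p. L \<le> c p j} \<subseteq> {..n + m}"
  proof
    fix p assume "p \<in> {p. L \<le> c p j}"
    then have "c p j \<noteq> 0" using assms(2) by auto
    from CC_nonzeroD(3)[OF assms(1) this] show "p \<in> {..n + m}" by simp
  qed
qed simp

lemma col_ge_eq:
  assumes c: "c \<in> CC n m" and L: "1 \<le> L"
  shows "{p. L \<le> c p j} = {1..card {p. L \<le> c p j}}"
proof (rule downward_closed_eq_atLeastAtMost)
  show "finite {p. L \<le> c p j}" by (rule finite_col_ge[OF assms])
  show "0 \<notin> {p. L \<le> c p j}" using c L by (simp add: CC_def plane_partition_def)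
next
  fix p q assume "1 \<le> p" "p \<le> q" "q \<in> {p. L \<le> c p j}"
  then show "p \<in> {p. L \<le> c p j}" using CC_col_mono[OF c, of p q j] by simp
qed

text \<open>Column \<open>j\<close> admits values up to \<open>n + m - j\<close>, and row
  \<open>i\<close> of \<open>B\<close> has levels up to \<open>i + m\<close>; the two bounds agree
  for \<open>j = n - i\<close>.\<close>

definition paths_of :: "nat \<Rightarrow> (nat \<Rightarrow> nat \<Rightarrow> nat) \<Rightarrow> (nat \<times> nat) set" where
  "paths_of n c = {(i, l). i < n \<and> l \<noteq> 0 \<and> (\<exists>p. c p (n - i) = l)}"

text \<open>The displacement of path \<open>i\<close> once level \<open>L\<close> has been passed.
  For an array it becomes the number of entries at least \<open>L\<close> in column
  \<open>n - i\<close>, and the bijection is verified by comparing these counts.\<close>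

definition tail_card :: "(nat \<times> nat) set \<Rightarrow> nat \<Rightarrow> nat \<Rightarrow> nat" where
  "tail_card X i L = card {l. (i, l) \<in> X \<and> L \<le> l}"

text \<open>Entry \<open>p\<close> of a column is the \<open>p\<close>-th largest level of its path,
  obtained as a conjugate of the counts. The guard \<open>n < j\<close> is needed because
  \<open>n - j\<close> truncates to 0 and would repeat column \<open>n\<close>.\<close>

definition array_of :: "nat \<Rightarrow> (nat \<times> nat) set \<Rightarrow> nat \<Rightarrow> nat \<Rightarrow> nat" where
  "array_of n X p j = (if p = 0 \<or> j = 0 \<or> n < j then 0
     else card {L. 1 \<le> L \<and> p \<le> tail_card X (n - j) L})"

lemma path_pos_eq_tail_card: "path_pos X L i = i + tail_card X i (Suc L)"
  by (simp add: path_pos_def tail_card_def Suc_le_eq)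

text \<open>Strictness down columns prevents two rows from giving the same level, so counting levels
  is counting rows.\<close>

lemma tail_card_paths_of:
  assumes c: "c \<in> CC n m" and L: "1 \<le> L" and i: "i < n"
  shows "tail_card (paths_of n c) i L = card {p. L \<le> c p (n - i)}"
proof -
  have "{l. (i, l) \<in> paths_of n c \<and> L \<le> l} = (\<lambda>p. c p (n - i)) ` {p. L \<le> c p (n - i)}"
    using L i by (auto simp: paths_of_def)
  moreover have "inj_on (\<lambda>p. c p (n - i)) {p. L \<le> c p (n - i)}"
  proof (rule inj_onI)
    fix p q assume pq: "p \<in> {p. L \<le> c p (n - i)}" "q \<in> {p. L \<le> c p (n - i)}"
      and eq: "c p (n - i) = c q (n - i)"
    have nz: "c p (n - i) \<noteq> 0" "c q (n - i) \<noteq> 0" using pq L by auto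
    have "1 \<le> p" "1 \<le> q" using CC_nonzeroD(1)[OF c] nz by auto
    then have "\<not> p < q" "\<not> q < p"
      using CC_col_strict[OF c, of p q "n - i"] CC_col_strict[OF c, of q p "n - i"] nz eq by auto
    then show "p = q" by simp
  qed
  ultimately show ?thesis by (simp add: tail_card_def card_image)
qed

lemma CC_ge_iff:
  assumes c: "c \<in> CC n m" and "1 \<le> L" "1 \<le> p" "1 \<le> j" "j \<le> n"
  shows "L \<le> c p j \<longleftrightarrow> p \<le> tail_card (paths_of n c) (n - j) L"
proof -
  have "tail_card (paths_of n c) (n - j) L = card {p. L \<le> c p j}"
    using tail_card_paths_of[OF c assms(2), of "n - j"] assms by simp
  moreover have "L \<le> c p j \<longleftrightarrow> p \<in> {1..card {p. L \<le> c p j}}"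
    using col_ge_eq[OF c assms(2)] by blast
  ultimately show ?thesis using assms(3) by simp
qed

lemma bounded_families_subset:
  "X \<in> bounded_families n m \<Longrightarrow> X \<subseteq> {..<n} \<times> {0<..n + m}"
  by (simp add: bounded_families_def path_families_def)

lemma finite_tail:
  assumes "X \<in> bounded_families n m"
  shows "finite {l. (i, l) \<in> X \<and> L \<le> l}"
  by (rule finite_subset[of _ "{0<..n + m}"]) (use bounded_families_subset[OF assms] in auto)

lemma tail_card_antimono:
  assumes "X \<in> bounded_families n m" "L \<le> L'"
  shows "tail_card X i L' \<le> tail_card X i L"
  unfolding tail_card_def
  by (rule card_mono[OF finite_tail[OF assms(1)]]) (use assms(2) in auto)

lemma tail_card_Suc:
  assumes "X \<in> bounded_families n m"
  shows "tail_card X i L = tail_card X i (Suc L) + (if (i, L) \<in> X then 1 else 0)"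
proof -
  have "{l. (i, l) \<in> X \<and> L \<le> l} = {l. (i, l) \<in> X \<and> Suc L \<le> l} \<union> (if (i, L) \<in> X then {L} else {})"
    by (auto simp: Suc_le_eq le_less)
  then show ?thesis using finite_tail[OF assms] by (auto simp: tail_card_def)
qed

text \<open>Strict order of the positions \<open>i + tail_card X i L\<close> at neighbouring
  \<open>i\<close> is weak order of the displacements. This is how nonintersection becomes weak
  decrease along rows.\<close>

lemma tail_card_mono:
  assumes X: "X \<in> bounded_families n m" and "Suc i < n" "1 \<le> L"
  shows "tail_card X i L \<le> tail_card X (Suc i) L"
proof -
  have "strict_mono_on {..<n} (path_pos X (L - 1))"
    using X by (simp add: bounded_families_def path_families_def)
  then have "path_pos X (L - 1) i < path_pos X (L - 1) (Suc i)"
    by (rule strict_mono_onD) (use assms in auto)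
  then show ?thesis using assms by (simp add: path_pos_eq_tail_card)
qed

lemma tail_card_pos:
  assumes X: "X \<in> bounded_families n m" and "1 \<le> tail_card X i L"
  shows "i < n" "L \<le> i + m" "tail_card X i L \<le> n + m"
proof -
  have "{l. (i, l) \<in> X \<and> L \<le> l} \<noteq> {}"
    using assms(2) unfolding tail_card_def by (metis card.empty not_one_le_zero)
  then obtain l where l: "(i, l) \<in> X" "L \<le> l" by auto
  then have "i < n" "l \<le> i + m" using X bounded_families_subset[OF X] by (auto simp: bounded_families_def)
  then show "i < n" "L \<le> i + m" using l by auto
  have "tail_card X i L \<le> card {0<..n + m}"
    unfolding tail_card_def using bounded_families_subset[OF X] by (intro card_mono) auto
  then show "tail_card X i L \<le> n + m" by simp
qed

text \<open>The counterpart of \<open>CC_ge_iff\<close>: both arrays are determined by the same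
  threshold counts, so the two maps are mutually inverse.\<close>

lemma array_of_ge_iff:
  assumes X: "X \<in> bounded_families n m" and "1 \<le> L" "1 \<le> p" "1 \<le> j" "j \<le> n"
  shows "L \<le> array_of n X p j \<longleftrightarrow> p \<le> tail_card X (n - j) L"
proof -
  let ?S = "{L. 1 \<le> L \<and> p \<le> tail_card X (n - j) L}"
  have "?S = {1..card ?S}"
  proof (rule downward_closed_eq_atLeastAtMost)
    show "finite ?S"
    proof (rule finite_subset)
      show "?S \<subseteq> {..n + m}"
      proof
        fix L assume "L \<in> ?S"
        then have "1 \<le> tail_card X (n - j) L" using assms(3) by simp
        from tail_card_pos(1,2)[OF X this] show "L \<in> {..n + m}" by simp
      qed
    qed simp
    show "0 \<notin> ?S" by simp
  next
    fix L L' assume "1 \<le> L" "L \<le> L'" "L' \<in> ?S"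
    then show "L \<in> ?S" using tail_card_antimono[OF X, of L L' "n - j"] by auto
  qed
  then have "L \<in> ?S \<longleftrightarrow> L \<in> {1..card ?S}" by blast
  then show ?thesis using assms by (simp add: array_of_def)
qed

lemma nat_leI_ge:
  assumes "\<And>L. 1 \<le> L \<Longrightarrow> L \<le> a \<Longrightarrow> L \<le> b"
  shows "a \<le> (b :: nat)"
  using assms[of a] by (cases "a = 0") auto

lemma nat_eqI_ge:
  assumes "\<And>L. 1 \<le> L \<Longrightarrow> L \<le> a \<longleftrightarrow> L \<le> b"
  shows "a = (b :: nat)"
  by (rule antisym; rule nat_leI_ge) (simp_all add: assms)

lemma array_of_nonzeroD:
  assumes X: "X \<in> bounded_families n m" and nz: "array_of n X p j \<noteq> 0"
  shows "1 \<le> p" "1 \<le> j" "j \<le> n" "p \<le> n + m" "array_of n X p j + j \<le> n + m"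
proof -
  show pj: "1 \<le> p" "1 \<le> j" "j \<le> n" using nz by (auto simp: array_of_def split: if_splits)
  have "1 \<le> array_of n X p j" using nz by simp
  then have "p \<le> tail_card X (n - j) (array_of n X p j)"
    using array_of_ge_iff[OF X _ pj, of "array_of n X p j"] by simp
  then have "1 \<le> tail_card X (n - j) (array_of n X p j)"
    "p \<le> tail_card X (n - j) (array_of n X p j)" using pj by auto
  from tail_card_pos[OF X this(1)] this(2) pj
  show "p \<le> n + m" "array_of n X p j + j \<le> n + m" by auto
qed

lemma array_of_in_CC:
  assumes X: "X \<in> bounded_families n m"
  shows "array_of n X \<in> CC n m"
proof -
  let ?c = "array_of n X"
  note nzD = array_of_nonzeroD[OF X]
  note ge_iff = array_of_ge_iff[OF X]
  have row: "?c p (Suc j) \<le> ?c p j" if "1 \<le> p" "1 \<le> j" for p j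
  proof (rule nat_leI_ge)
    fix L assume L: "1 \<le> L" "L \<le> ?c p (Suc j)"
    then have j: "Suc j \<le> n" using nzD(3)[of p "Suc j"] by linarith
    then have "p \<le> tail_card X (n - Suc j) L" using L that ge_iff[of L p "Suc j"] by simp
    also have "\<dots> \<le> tail_card X (Suc (n - Suc j)) L"
      using j that L by (intro tail_card_mono[OF X]) auto
    also have "Suc (n - Suc j) = n - j" using j by simp
    finally show "L \<le> ?c p j" using L that j ge_iff[of L p j] by simp
  qed
  have col: "?c (Suc p) j \<le> ?c p j" if "1 \<le> p" "1 \<le> j" for p j
  proof (rule nat_leI_ge)
    fix L assume L: "1 \<le> L" "L \<le> ?c (Suc p) j"
    then have j: "j \<le> n" using nzD(3)[of "Suc p" j] by linarith
    then show "L \<le> ?c p j" using L that ge_iff[of L "Suc p" j] ge_iff[of L p j] by simp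
  qed
  have strict: "?c (Suc p) j < ?c p j" if "1 \<le> p" "?c (Suc p) j \<noteq> 0" for p j
  proof -
    let ?L = "?c (Suc p) j"
    have j: "1 \<le> j" "j \<le> n" using nzD(2,3)[OF that(2)] by auto
    have "Suc p \<le> tail_card X (n - j) ?L" using that j ge_iff[of ?L "Suc p" j] by simp
    \<comment> \<open>A path steps at most once per level, so the count drops by at most one from
      \<open>?L\<close> to \<open>Suc ?L\<close>; the entry above is therefore larger than
      \<open>?L\<close>.\<close>
    then have "p \<le> tail_card X (n - j) (Suc ?L)"
      using tail_card_Suc[OF X, of "n - j" ?L] by (auto split: if_splits)
    then show ?thesis using ge_iff[of "Suc ?L" p j] that j by simp
  qed
  have "{(i, j). ?c i j \<noteq> 0} \<subseteq> {..n + m} \<times> {..n}"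
    using nzD(3,4) by auto
  then have "finite {(i, j). ?c i j \<noteq> 0}" by (rule finite_subset) simp
  moreover have "card {j. \<exists>i. ?c i j \<noteq> 0} \<le> n"
  proof -
    have "{j. \<exists>i. ?c i j \<noteq> 0} \<subseteq> {1..n}" using nzD(2,3) by auto
    from card_mono[OF _ this] show ?thesis by simp
  qed
  moreover have "?c i j = 0" if "i = 0 \<or> j = 0" for i j using that by (auto simp: array_of_def)
  ultimately show ?thesis
    unfolding CC_def plane_partition_def using row col strict nzD(5) by auto
qed

lemma mem_paths_of_iff:
  assumes c: "c \<in> CC n m" and "i < n" "l \<noteq> 0"
  shows "(i, l) \<in> paths_of n c \<longleftrightarrow> tail_card (paths_of n c) i (Suc l) < tail_card (paths_of n c) i l"
proof -
  let ?\<tau> = "tail_card (paths_of n c) i"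
  have iff: "L \<le> c p (n - i) \<longleftrightarrow> p \<le> ?\<tau> L" if "1 \<le> L" "1 \<le> p" for L p
    using CC_ge_iff[OF c that, of "n - i"] assms by simp
  have "(i, l) \<in> paths_of n c \<longleftrightarrow> (\<exists>p\<ge>1. c p (n - i) = l)"
    using assms CC_nonzeroD(1)[OF c] by (auto simp: paths_of_def)
  also have "\<dots> \<longleftrightarrow> (\<exists>p\<ge>1. l \<le> c p (n - i) \<and> \<not> Suc l \<le> c p (n - i))"
    by (auto simp: Suc_le_eq not_less)
  also have "\<dots> \<longleftrightarrow> (\<exists>p\<ge>1. p \<le> ?\<tau> l \<and> \<not> p \<le> ?\<tau> (Suc l))"
    using iff assms(3) by (intro ex_cong1) auto
  also have "\<dots> \<longleftrightarrow> ?\<tau> (Suc l) < ?\<tau> l"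
    by (auto intro!: exI[of _ "?\<tau> l"])
  finally show ?thesis .
qed

lemma paths_of_in_bounded_families:
  assumes c: "c \<in> CC n m"
  shows "paths_of n c \<in> bounded_families n m"
proof -
  have bound: "i < n \<and> 0 < l \<and> l \<le> i + m \<and> l \<le> n + m" if "(i, l) \<in> paths_of n c" for i l
  proof -
    from that obtain p where p: "i < n" "c p (n - i) = l" "l \<noteq> 0" by (auto simp: paths_of_def)
    then have "l + (n - i) \<le> n + m" using CC_nonzeroD(4)[OF c, of p "n - i"] by simp
    then show ?thesis using p by auto
  qed
  have "strict_mono_on {..<n} (path_pos (paths_of n c) L)" for L
  proof (rule strict_mono_onI)
    fix i i' assume i: "i \<in> {..<n}" "i' \<in> {..<n}" "i < i'"
    have "tail_card (paths_of n c) i (Suc L) = card {p. Suc L \<le> c p (n - i)}"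
      using i by (intro tail_card_paths_of[OF c]) auto
    also have "\<dots> \<le> card {p. Suc L \<le> c p (n - i')}"
    proof (rule card_mono)
      show "finite {p. Suc L \<le> c p (n - i')}" by (rule finite_col_ge[OF c]) simp
      show "{p. Suc L \<le> c p (n - i)} \<subseteq> {p. Suc L \<le> c p (n - i')}"
      proof
        fix p assume "p \<in> {p. Suc L \<le> c p (n - i)}"
        moreover have "c p (n - i) \<le> c p (n - i')"
          using i by (intro CC_row_mono[OF c]) auto
        ultimately show "p \<in> {p. Suc L \<le> c p (n - i')}" by simp
      qed
    qed
    also have "\<dots> = tail_card (paths_of n c) i' (Suc L)"
      using i by (intro tail_card_paths_of[OF c, symmetric]) auto
    finally show "path_pos (paths_of n c) L i < path_pos (paths_of n c) L i'"
      using i(3) by (simp add: path_pos_eq_tail_card)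
  qed
  then show ?thesis using bound by (auto simp: bounded_families_def path_families_def)
qed

lemma bij_betw_paths_of: "bij_betw (paths_of n) (CC n m) (bounded_families n m)"
proof (rule bij_betw_byWitness[where f' = "array_of n"])
  show "\<forall>c\<in>CC n m. array_of n (paths_of n c) = c"
  proof (intro ballI ext)
    fix c p j assume c: "c \<in> CC n m"
    note X = paths_of_in_bounded_families[OF c]
    show "array_of n (paths_of n c) p j = c p j"
    proof (cases "1 \<le> p \<and> 1 \<le> j \<and> j \<le> n")
      case True
      then show ?thesis
        by (intro nat_eqI_ge) (simp add: array_of_ge_iff[OF X] CC_ge_iff[OF c])
    next
      case False
      then have "c p j = 0"
        using CC_nonzeroD(1,2)[OF c, of p j] CC_col_le[OF c, of p j] by blast
      moreover have "array_of n (paths_of n c) p j = 0"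
        using False array_of_nonzeroD(1-3)[OF X, of p j] by blast
      ultimately show ?thesis by simp
    qed
  qed
  show "\<forall>X\<in>bounded_families n m. paths_of n (array_of n X) = X"
  proof
    fix X assume X: "X \<in> bounded_families n m"
    let ?c = "array_of n X"
    note c = array_of_in_CC[OF X]
    have \<tau>: "tail_card (paths_of n ?c) i L = tail_card X i L" if "i < n" "1 \<le> L" for i L
    proof (rule nat_eqI_ge)
      fix p :: nat assume p: "1 \<le> p"
      show "p \<le> tail_card (paths_of n ?c) i L \<longleftrightarrow> p \<le> tail_card X i L"
        using CC_ge_iff[OF c that(2) p, of "n - i"] array_of_ge_iff[OF X that(2) p, of "n - i"] that
        by simp
    qed
    have "(i, l) \<in> paths_of n ?c \<longleftrightarrow> (i, l) \<in> X" for i l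
    proof (cases "i < n \<and> l \<noteq> 0")
      case True
      then have "(i, l) \<in> paths_of n ?c \<longleftrightarrow> tail_card X i (Suc l) < tail_card X i l"
        by (simp add: mem_paths_of_iff[OF c] \<tau>)
      also have "\<dots> \<longleftrightarrow> (i, l) \<in> X" using tail_card_Suc[OF X, of i l] by simp
      finally show ?thesis .
    next
      case False
      then show ?thesis using bounded_families_subset[OF X] by (auto simp: paths_of_def)
    qed
    then show "paths_of n ?c = X" by auto
  qed
qed (use paths_of_in_bounded_families array_of_in_CC in auto)

section \<open>Weights\<close>

lemma finite_row_ge:
  assumes "c \<in> CC n m" "1 \<le> L"
  shows "finite {l. L \<le> c p l}"
proof (rule finite_subset)
  show "{l. L \<le> c p l} \<subseteq> {..n + m}"
  proof
    fix l assume "l \<in> {l. L \<le> c p l}"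
    then have "c p l \<noteq> 0" using assms(2) by auto
    from CC_nonzeroD(4)[OF assms(1) this] show "l \<in> {..n + m}" by simp
  qed
qed simp

lemma card_row_ge_Suc:
  assumes c: "c \<in> CC n m" and L: "1 \<le> L"
  shows "card {l. L \<le> c p l} = card {l. Suc L \<le> c p l} + card {l. c p l = L}"
proof -
  have "{l. L \<le> c p l} = {l. Suc L \<le> c p l} \<union> {l. c p l = L}" by auto
  moreover have "finite {l. c p l = L}"
    by (rule finite_subset[OF _ finite_row_ge[OF c L, of p]]) auto
  ultimately show ?thesis
    using finite_row_ge[OF c, of "Suc L" p] by (simp add: card_Un_disjoint disjoint_iff)
qed

lemma row_ge_empty:
  assumes c: "c \<in> CC n m" and "1 \<le> L" "n + m < L + p"
  shows "{l. L \<le> c p l} = {}"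
proof -
  have "\<not> L \<le> c p l" for l
  proof
    assume L: "L \<le> c p l"
    then have "c p l \<noteq> 0" using assms(2) by simp
    from CC_nonzeroD(3)[OF c this] show False using L assms(3) by simp
  qed
  then show ?thesis by simp
qed

text \<open>Strictness down columns forces \<open>r + p <= n + m\<close> for an entry
  \<open>r\<close> in row \<open>p\<close>, which gives the range of rows.\<close>

lemma multiplicity_eq_sum_rows:
  assumes c: "c \<in> CC n m" and r: "1 \<le> r"
  shows "multiplicity_in c r = (\<Sum>p<n + m - r. card {l. c (Suc p) l = r})"
proof -
  have "{(i, j). c i j = r} = (SIGMA p:{1..n + m - r}. {l. c p l = r})"
  proof (intro equalityI subsetI)
    fix z assume "z \<in> {(i, j). c i j = r}"
    then obtain i j where z: "z = (i, j)" "c i j = r" by auto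
    then have "c i j \<noteq> 0" using r by simp
    from CC_nonzeroD(1,3)[OF c this] show "z \<in> (SIGMA p:{1..n + m - r}. {l. c p l = r})"
      using z by auto
  qed auto
  then have "multiplicity_in c r = card (SIGMA p:{1..n + m - r}. {l. c p l = r})"
    by (simp add: multiplicity_in_def)
  also have "\<dots> = (\<Sum>p=1..n + m - r. card {l. c p l = r})"
  proof (rule card_SigmaI)
    show "\<forall>p\<in>{1..n + m - r}. finite {l. c p l = r}"
      by (intro ballI finite_subset[OF _ finite_row_ge[OF c r]]) auto
  qed simp
  also have "\<dots> = (\<Sum>p<n + m - r. card {l. c (Suc p) l = r})"
    by (simp add: sum.atLeast1_atMost_eq)
  finally show ?thesis .
qed

text \<open>The entries at least \<open>k\<close> fill an initial segment of row 1, and column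
  \<open>j\<close> allows at most \<open>n + m - j\<close>. The segment thus ends by column
  \<open>n + m - k\<close>, reaching it only with the value \<open>k\<close> there.\<close>

lemma row_length_eq_iff:
  assumes c: "c \<in> CC n m" and k: "1 \<le> k" "k < n + m"
  shows "card {l. k \<le> c 1 l} < n + m - k \<longleftrightarrow> c 1 (n + m - k) \<noteq> k"
proof -
  have eq: "{l. k \<le> c 1 l} = {1..card {l. k \<le> c 1 l}}"
  proof (rule downward_closed_eq_atLeastAtMost)
    show "finite {l. k \<le> c 1 l}" by (rule finite_row_ge[OF c k(1)])
    show "0 \<notin> {l. k \<le> c 1 l}" using c k by (simp add: CC_def plane_partition_def)
  next
    fix p q assume "1 \<le> p" "p \<le> q" "q \<in> {l. k \<le> c 1 l}"
    then show "p \<in> {l. k \<le> c 1 l}" using CC_row_mono[OF c, of p q 1] by simp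
  qed
  have "n + m - k \<in> {l. k \<le> c 1 l} \<longleftrightarrow> n + m - k \<le> card {l. k \<le> c 1 l}"
    using k by (subst eq) auto
  moreover have "k \<le> c 1 (n + m - k) \<longleftrightarrow> c 1 (n + m - k) = k"
  proof
    assume le: "k \<le> c 1 (n + m - k)"
    then have "c 1 (n + m - k) \<noteq> 0" using k by simp
    from CC_nonzeroD(4)[OF c this] show "c 1 (n + m - k) = k" using le k by simp
  qed simp
  ultimately show ?thesis by auto
qed

section \<open>The exponent of \<open>t r\<close>\<close>

text \<open>The two entries of \<open>Phi\<close> count values at least \<open>r\<close> in one row
  and at least \<open>Suc r\<close> in the row before it. After shifting the row index, the two sums
  differ by the number of entries equal to \<open>r\<close>.\<close>

lemma U_stat_diagonal_part:
  assumes c: "c \<in> CC n m" and r: "1 \<le> r" "r \<le> n + m"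
  shows "(\<Sum>s=1..n+m-r. extend_array n m (Phi n m c) s (s + r - 1) -
      extend_array n m (Phi n m c) s (s + r)) = int (n + m - r) - int (multiplicity_in c r)"
proof -
  define Q where "Q = n + m - r"
  define R where "R p L = int (card {l. L \<le> c p l})" for p L
  \<comment> \<open>Row 0 stands for the added boundary column: at \<open>s = Q\<close> the extended
    entry is \<open>n - Q\<close>, as if row 0 had \<open>Q\<close> large entries.\<close>
  define \<rho> where "\<rho> p = (if p = 0 then int Q else R p (Suc r))" for p
  have "(\<Sum>s=1..Q. extend_array n m (Phi n m c) s (s + r - 1) -
      extend_array n m (Phi n m c) s (s + r)) = (\<Sum>s=1..Q. \<rho> (Q - s) - R (Suc (Q - s)) r)"
  proof (rule sum.cong[OF refl])
    fix s assume s: "s \<in> {1..Q}"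
    have idx: "n + m - (s + r - 1) = Suc (Q - s)" "n + m - (s + r) = Q - s"
      "1 + (s + r - 1) - s = r" "1 + (s + r) - s = Suc r" "s + r - 1 \<noteq> n + m"
      "s + r = n + m \<longleftrightarrow> Q - s = 0"
      using s r by (auto simp: Q_def)
    have "extend_array n m (Phi n m c) s (s + r - 1) = int n - R (Suc (Q - s)) r"
      unfolding extend_array_def Phi_def idx(1,3) R_def using s idx(5) by simp
    moreover have "extend_array n m (Phi n m c) s (s + r) = int n - \<rho> (Q - s)"
    proof (cases "Q - s = 0")
      case True
      then have "s = Q" using s by simp
      then show ?thesis using True idx(6) by (simp add: extend_array_def \<rho>_def)
    next
      case False
      then show ?thesis unfolding extend_array_def Phi_def idx(2,4,6) R_def \<rho>_def using s by simp
    qed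
    ultimately show "extend_array n m (Phi n m c) s (s + r - 1) -
        extend_array n m (Phi n m c) s (s + r) = \<rho> (Q - s) - R (Suc (Q - s)) r" by simp
  qed
  also have "\<dots> = (\<Sum>k<Q. \<rho> (Q - Suc k) - R (Suc (Q - Suc k)) r)"
    by (simp add: sum.atLeast1_atMost_eq)
  also have "\<dots> = (\<Sum>k<Q. \<rho> k - R (Suc k) r)"
    by (rule sum.nat_diff_reindex)
  also have "\<dots> = (\<Sum>k<Q. \<rho> k) - (\<Sum>k<Q. R (Suc k) r)" by (rule sum_subtractf)
  also have "(\<Sum>k<Q. \<rho> k) = int Q + (\<Sum>k<Q. R (Suc k) (Suc r))"
  proof (cases Q)
    case (Suc q)
    \<comment> \<open>Row \<open>Q\<close> has no entry above \<open>r\<close>, so it can be added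
      to align both sums on rows 1 to \<open>Q\<close>.\<close>
    have "{l. Suc r \<le> c (Suc q) l} = {}"
      using Suc by (intro row_ge_empty[OF c]) (auto simp: Q_def)
    then have "R (Suc q) (Suc r) = 0" unfolding R_def by (simp only: card.empty of_nat_0)
    moreover have "(\<Sum>k<Suc q. \<rho> k) = \<rho> 0 + (\<Sum>k<q. \<rho> (Suc k))"
      by (rule sum.lessThan_Suc_shift)
    ultimately show ?thesis using Suc by (simp add: \<rho>_def)
  qed simp
  also have "(\<Sum>k<Q. R (Suc k) r) = (\<Sum>k<Q. R (Suc k) (Suc r)) + int (multiplicity_in c r)"
    unfolding multiplicity_eq_sum_rows[OF c r(1)] Q_def[symmetric] R_def card_row_ge_Suc[OF c r(1)]
    by (simp add: sum.distrib)
  finally show ?thesis by (simp add: Q_def)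
qed

text \<open>With \<open>k = n + m - s\<close> the index runs over 1 to \<open>r - 1\<close>, and by
  \<open>row_length_eq_iff\<close> the indicator fails exactly at a maximal first-row entry
  \<open>k\<close>.\<close>

lemma U_stat_boundary_part:
  assumes c: "c \<in> CC n m" and r: "1 \<le> r" "r \<le> n + m"
  shows "(\<Sum>s=n+m-r+1..n+m-1. if extend_array n m (Phi n m c) s (n + m - 1) > int n - int s
      then 1 else 0) = int r - 1 - int (card {k \<in> {1..<r}. c 1 (n + m - k) = k})"
proof -
  have "(\<Sum>s=n+m-r+1..n+m-1. if extend_array n m (Phi n m c) s (n + m - 1) > int n - int s
      then 1 else 0) = (\<Sum>k\<in>{1..<r}. 1 - (if c 1 (n + m - k) = k then 1 else 0 :: int))"
  proof (rule sum.reindex_bij_witness[where i = "\<lambda>k. n + m - k" and j = "\<lambda>s. n + m - s"])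
    fix s assume s: "s \<in> {n+m-r+1..n+m-1}"
    then show "n + m - (n + m - s) = s" "n + m - s \<in> {1..<r}" using r by auto
    define k where "k = n + m - s"
    have k: "1 \<le> k" "k < n + m" "s = n + m - k" using s r by (auto simp: k_def)
    have idx: "n + m - (n + m - 1) = 1" "1 + (n + m - 1) - s = k" "n + m - 1 \<noteq> n + m" "s \<noteq> 0"
      using k by auto
    have "extend_array n m (Phi n m c) s (n + m - 1) = int n - int (card {l. k \<le> c 1 l})"
      unfolding extend_array_def Phi_def idx(1,2) using idx(3,4) by simp
    then have "extend_array n m (Phi n m c) s (n + m - 1) > int n - int s \<longleftrightarrow>
        card {l. k \<le> c 1 l} < n + m - k"
      using k(3) by simp
    then have "extend_array n m (Phi n m c) s (n + m - 1) > int n - int s \<longleftrightarrow> c 1 (n + m - k) \<noteq> k"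
      by (simp only: row_length_eq_iff[OF c k(1,2)])
    then show "1 - (if c 1 (n + m - (n + m - s)) = n + m - s then 1 else 0) =
        (if extend_array n m (Phi n m c) s (n + m - 1) > int n - int s then 1 else (0::int))"
      unfolding k_def by simp
  next
    fix k assume "k \<in> {1..<r}"
    then show "n + m - (n + m - k) = k" "n + m - k \<in> {n+m-r+1..n+m-1}" using r by auto
  qed
  also have "\<dots> = int r - 1 - int (card {k \<in> {1..<r}. c 1 (n + m - k) = k})"
    using r by (simp add: sum_subtractf sum.inter_filter[symmetric] of_nat_diff)
  finally show ?thesis .
qed

text \<open>The constants \<open>n + m - r\<close> and \<open>r - 1\<close> of the two parts add up
  to \<open>n + m - 1\<close>, so subtracting \<open>U_r\<close> leaves just the two counts.\<close>

lemma Ubar_eq: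
  assumes c: "c \<in> CC n m" and r: "1 \<le> r" "r \<le> n + m"
  shows "Ubar n m r c = int (multiplicity_in c r + card {k \<in> {1..<r}. c 1 (n + m - k) = k})"
  unfolding Ubar_def U_stat_def U_stat_diagonal_part[OF assms] U_stat_boundary_part[OF assms]
  using r by (simp add: of_nat_diff)

lemma multiplicity_eq_card_paths_of:
  assumes c: "c \<in> CC n m" and r: "1 \<le> r"
  shows "multiplicity_in c r = card {z \<in> paths_of n c. snd z = r}"
proof -
  have col: "1 \<le> j \<and> j \<le> n" if "c p j = r" for p j
    using that r CC_nonzeroD(2)[OF c, of p j] CC_col_le[OF c, of p j] by simp
  have "{z \<in> paths_of n c. snd z = r} = (\<lambda>(p, j). (n - j, r)) ` {(p, j). c p j = r}"
  proof (intro equalityI subsetI)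
    fix z assume "z \<in> {z \<in> paths_of n c. snd z = r}"
    then obtain i p where "z = (i, r)" "i < n" "c p (n - i) = r" by (auto simp: paths_of_def)
    then show "z \<in> (\<lambda>(p, j). (n - j, r)) ` {(p, j). c p j = r}"
      by (intro image_eqI[of _ _ "(p, n - i)"]) auto
  next
    fix z assume "z \<in> (\<lambda>(p, j). (n - j, r)) ` {(p, j). c p j = r}"
    then obtain p j where z: "z = (n - j, r)" "c p j = r" by auto
    then show "z \<in> {z \<in> paths_of n c. snd z = r}"
      using col[OF z(2)] r by (auto simp: paths_of_def)
  qed
  moreover have "inj_on (\<lambda>(p, j). (n - j, r)) {(p, j). c p j = r}"
  proof (rule inj_onI)
    fix y z assume "y \<in> {(p, j). c p j = r}" "z \<in> {(p, j). c p j = r}"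
      and eq: "(\<lambda>(p, j). (n - j, r)) y = (\<lambda>(p, j). (n - j, r)) z"
    then obtain p j q k where yz: "y = (p, j)" "z = (q, k)" "c p j = r" "c q k = r" by auto
    then have "j = k" using eq col[OF yz(3)] col[OF yz(4)] by auto
    moreover have "1 \<le> p" "1 \<le> q"
      using CC_nonzeroD(1)[OF c, of p j] CC_nonzeroD(1)[OF c, of q k] yz r by auto
    then have "\<not> p < q" "\<not> q < p"
      using CC_col_strict[OF c, of p q j] CC_col_strict[OF c, of q p j] yz r \<open>j = k\<close> by auto
    ultimately show "y = z" using yz by simp
  qed
  ultimately show ?thesis by (simp add: multiplicity_in_def card_image)
qed

text \<open>At level \<open>i + m\<close>, the highest allowed to path \<open>i\<close>, the path is
  still at position \<open>i\<close>; at lower levels its position plus \<open>m\<close> already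
  exceeds the level.\<close>

lemma edge_weight_eq_row_weight:
  assumes X: "X \<in> bounded_families n m" and il: "(i, l) \<in> X"
  shows "edge_weight n m t x l (path_pos X l i) = row_weight n m t x i l"
proof -
  have le: "l' \<le> i + m" if "(i, l') \<in> X" for l' using X that by (auto simp: bounded_families_def)
  show ?thesis
  proof (cases "l = i + m")
    case True
    then have "{l'. (i, l') \<in> X \<and> l < l'} = {}" using le by (auto simp: not_less)
    then have "path_pos X l i = i" unfolding path_pos_def by (simp only: card.empty)
    then show ?thesis using True by (simp add: edge_weight_def row_weight_def)
  next
    case False
    moreover have "i \<le> path_pos X l i" by (simp add: path_pos_def)
    ultimately have "l < path_pos X l i + m" using le[OF il] by simp
    then show ?thesis using False by (simp add: edge_weight_def row_weight_def)
  qed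
qed

text \<open>A step of path \<open>i\<close> at level \<open>i + m\<close> is an entry attaining the
  bound of column \<open>n - i\<close>. The first-row entry of that column is at least as large,
  hence equal to it.\<close>

lemma prod_paths_of_top:
  assumes c: "c \<in> CC n m"
  shows "(\<Prod>(i, l)\<in>paths_of n c. if l = i + m then g l else 1) =
    (\<Prod>k\<in>{k \<in> {1..n + m}. c 1 (n + m - k) = k}. g k)"
proof -
  let ?X = "paths_of n c"
  have fin: "finite ?X"
    using bounded_families_subset[OF paths_of_in_bounded_families[OF c]] finite_subset by blast
  have "(\<Prod>(i, l)\<in>?X. if l = i + m then g l else 1) = (\<Prod>z\<in>{z \<in> ?X. snd z = fst z + m}. g (snd z))"
    by (subst prod.inter_filter[OF fin]) (simp add: case_prod_unfold)
  also have "\<dots> = (\<Prod>k\<in>{k \<in> {1..n + m}. c 1 (n + m - k) = k}. g k)"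
  proof (rule prod.reindex_bij_witness[where i = "\<lambda>k. (k - m, k)" and j = snd])
    fix z assume "z \<in> {z \<in> ?X. snd z = fst z + m}"
    then obtain i p where z: "z = (i, i + m)" "i < n" "i + m \<noteq> 0" "c p (n - i) = i + m"
      by (auto simp: paths_of_def)
    have nz: "c p (n - i) \<noteq> 0" using z by simp
    have p: "1 \<le> p" by (rule CC_nonzeroD(1)[OF c nz])
    have "c p (n - i) \<le> c 1 (n - i)" by (rule CC_col_mono[OF c _ p]) simp
    then have "c 1 (n - i) \<noteq> 0" "i + m \<le> c 1 (n - i)" using z by auto
    then have "c 1 (n - i) = i + m"
      using CC_nonzeroD(4)[OF c, of 1 "n - i"] z by simp
    then show "snd z \<in> {k \<in> {1..n + m}. c 1 (n + m - k) = k}"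
      using z by (auto simp: Suc_le_eq)
    show "(snd z - m, snd z) = z" using z by simp
  next
    fix k assume "k \<in> {k \<in> {1..n + m}. c 1 (n + m - k) = k}"
    then have k: "1 \<le> k" "k \<le> n + m" "c 1 (n + m - k) = k" by auto
    have nz: "c 1 (n + m - k) \<noteq> 0" using k by simp
    have "m \<le> k" "k < n + m" using CC_col_le[OF c nz] CC_nonzeroD(2)[OF c nz] k by auto
    moreover from this have "n - (k - m) = n + m - k" by simp
    ultimately show "(k - m, k) \<in> {z \<in> ?X. snd z = fst z + m}"
      using k by (auto simp: paths_of_def)
    show "snd (k - m, k) = k" by simp
  qed simp
  finally show ?thesis .
qed

text \<open>Splitting \<open>T_l\<close> into \<open>t l\<close> and the later \<open>t r\<close>
  leaves \<open>t l * x l\<close> for each step, which accounts for the multiplicities, and an extra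
  product for each top step.\<close>

lemma cc_weight_eq_path_weight:
  assumes c: "c \<in> CC n m"
  shows "cc_weight n m t x c = path_weight (edge_weight n m t x) (paths_of n c)"
proof -
  let ?X = "paths_of n c" and ?M = "n + m"
  let ?D = "\<lambda>k. c 1 (?M - k) = k"
  note X = paths_of_in_bounded_families[OF c]
  have fin: "finite ?X" using bounded_families_subset[OF X] finite_subset by blast
  have "path_weight (edge_weight n m t x) ?X =
      (\<Prod>(i, l)\<in>?X. (t l * x l) * (if l = i + m then prod t {Suc l..?M} else 1))"
    unfolding path_weight_def
  proof (intro prod.cong refl, clarify)
    fix i l assume il: "(i, l) \<in> ?X"
    then have "l \<le> ?M" using bounded_families_subset[OF X] by auto
    then have T: "T_prod n m t l = t l * prod t {Suc l..?M}"
      unfolding T_prod_def by (rule prod.atLeast_Suc_atMost)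
    then show "edge_weight n m t x l (path_pos ?X l i) =
        (t l * x l) * (if l = i + m then prod t {Suc l..?M} else 1)"
      by (simp only: edge_weight_eq_row_weight[OF X il] row_weight_def T) (simp add: mult_ac)
  qed
  also have "\<dots> = (\<Prod>z\<in>?X. t (snd z) * x (snd z)) *
      (\<Prod>(i, l)\<in>?X. if l = i + m then prod t {Suc l..?M} else 1)"
    by (simp add: case_prod_unfold prod.distrib)
  also have "(\<Prod>z\<in>?X. t (snd z) * x (snd z)) =
      (\<Prod>r\<in>{1..?M}. \<Prod>z\<in>{z \<in> ?X. snd z = r}. t (snd z) * x (snd z))"
    using bounded_families_subset[OF X] by (intro prod.group[symmetric] fin) auto
  also have "\<dots> = (\<Prod>r\<in>{1..?M}. (t r * x r) ^ multiplicity_in c r)"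
    by (intro prod.cong refl) (simp add: multiplicity_eq_card_paths_of[OF c])
  also have "(\<Prod>(i, l)\<in>?X. if l = i + m then prod t {Suc l..?M} else 1) =
      (\<Prod>k\<in>{k \<in> {1..?M}. ?D k}. prod t {Suc k..?M})"
    by (rule prod_paths_of_top[OF c])
  also have "\<dots> = (\<Prod>k\<in>{k \<in> {1..?M}. ?D k}. \<Prod>r\<in>{r \<in> {1..?M}. k < r}. t r)"
    by (intro prod.cong refl) auto
  \<comment> \<open>Exchanging the products collects, for each \<open>r\<close>, one
    \<open>t r\<close> per maximal entry \<open>k < r\<close>.\<close>
  also have "\<dots> = (\<Prod>r\<in>{1..?M}. \<Prod>k\<in>{k \<in> {k \<in> {1..?M}. ?D k}. k < r}. t r)"
    by (rule prod.swap_restrict) auto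
  also have "\<dots> = (\<Prod>r\<in>{1..?M}. t r ^ card {k \<in> {1..<r}. ?D k})"
    by (intro prod.cong refl) (auto intro!: arg_cong[of _ _ "\<lambda>S. _ ^ card S"])
  finally have "path_weight (edge_weight n m t x) ?X =
      (\<Prod>r\<in>{1..?M}. (t r * x r) ^ multiplicity_in c r) *
      (\<Prod>r\<in>{1..?M}. t r ^ card {k \<in> {1..<r}. ?D k})" .
  also have "\<dots> = (\<Prod>r=1..?M. t r ^ nat (Ubar n m r c)) * (\<Prod>i=1..?M. x i ^ multiplicity_in c i)"
    by (simp add: Ubar_eq[OF c] nat_plus_as_int[symmetric] power_add power_mult_distrib prod.distrib mult_ac del: of_nat_add)
  finally show ?thesis by (simp add: cc_weight_def)
qed

section \<open>The Pfaffian identity\<close>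

lemma matching_sum_cong:
  assumes "\<And>i j. i < 2 * h \<Longrightarrow> j < 2 * h \<Longrightarrow> a i j = b i j"
  shows "matching_sum h a = matching_sum h b"
  unfolding matching_sum_def
proof (intro sum.cong refl arg_cong2[where f = "(*)"] prod.cong)
  fix p i assume "p \<in> pf_perms h" "i \<in> {..<h}"
  then have "p (2 * i) < 2 * h" "p (2 * i + 1) < 2 * h"
    using permutes_in_image[OF pf_perms_permutes, of p h "2 * i"]
      permutes_in_image[OF pf_perms_permutes, of p h "2 * i + 1"] by auto
  then show "a (p (2 * i)) (p (2 * i + 1)) = b (p (2 * i)) (p (2 * i + 1))" by (rule assms)
qed

lemma pick_image:
  assumes "finite I"
  shows "pick I ` {..<card I} = I"
proof (intro equalityI subsetI)
  fix x assume x: "x \<in> I"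
  then have "{a \<in> I. a < x} \<subset> I" by auto
  then have "card {a \<in> I. a < x} < card I" by (rule psubset_card_mono[OF assms])
  then show "x \<in> pick I ` {..<card I}"
    using pick_card_in_set[OF x] by (intro image_eqI[of _ _ "card {a \<in> I. a < x}"]) auto
qed (use pick_in_set in auto)

lemma strict_mono_on_pick: "strict_mono_on {..<card I} (pick I)"
  by (rule strict_mono_onI) (simp add: pick_mono)

text \<open>\<open>submatrix\<close> renumbers through the increasing map \<open>pick\<close>, which
  the set form of the Pfaffian undoes. The offset \<open>b\<close> is where \<open>A\<close> sits
  inside the block matrix.\<close>

lemma pfaffian_principal_submatrix:
  assumes A: "A \<in> carrier_mat d d" and K: "K \<subseteq> {..<d}" and card: "card ({..<d} - K) = 2 * h"
    and a: "\<And>i j. i < d \<Longrightarrow> j < d \<Longrightarrow> a (b + i) (b + j) = A $$ (i, j)"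
  shows "pfaffian (principal_submatrix A ({1..d} - Suc ` K)) =
    set_pf a h ({b..<b + d} - (\<lambda>i. b + i) ` K)"
proof -
  define I where "I = {..<d} - K"
  have I: "finite I" "card I = 2 * h" using card by (simp_all add: I_def)
  have "{i. Suc i \<in> {1..d} - Suc ` K} = I" by (auto simp: I_def)
  then have sub: "principal_submatrix A ({1..d} - Suc ` K) = submatrix A I I"
    by (simp add: principal_submatrix_def)
  have "{i. i < d \<and> i \<in> I} = I" by (auto simp: I_def)
  then have dim: "card {i. i < dim_row A \<and> i \<in> I} = 2 * h" "card {j. j < dim_col A \<and> j \<in> I} = 2 * h"
    using A I by auto
  have pick: "pick I i < d" if "i < 2 * h" for i
    using pick_in_set[of i I] that I by (auto simp: I_def)
  have "pfaffian (submatrix A I I) = matching_sum h (\<lambda>i j. submatrix A I I $$ (i, j))"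
    by (rule pfaffian_eq_matching_sum) (simp only: dim_submatrix dim)
  also have "\<dots> = matching_sum h (\<lambda>i j. a (b + pick I i) (b + pick I j))"
    by (rule matching_sum_cong) (subst submatrix_index, simp_all only: dim a pick)
  also have "\<dots> = set_pf a h ((\<lambda>i. b + pick I i) ` {..<2 * h})"
    using strict_mono_on_pick[of I] unfolding I
    by (intro matching_sum_eq_set_pf) (simp add: strict_mono_on_def)
  also have "(\<lambda>i. b + pick I i) ` {..<2 * h} = (\<lambda>i. b + i) ` I"
    using pick_image[OF I(1)] unfolding I(2) by (simp add: image_image[symmetric])
  also have "(\<lambda>i. b + i) ` I = {b..<b + d} - (\<lambda>i. b + i) ` K"
  proof -
    have "(\<lambda>i. b + i) ` {..<d} = {b..<b + d}"
      by (simp add: lessThan_atLeast0 add.commute)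
    then show ?thesis unfolding I_def by (subst image_set_diff) (auto simp: inj_def)
  qed
  finally show ?thesis unfolding sub .
qed

text \<open>Of the \<open>k i\<close> indices below the \<open>i\<close>-th chosen column, exactly
  \<open>i\<close> are chosen.\<close>

lemma cross_card_shifted:
  assumes k: "strict_mono_on {..<n} k" and range: "k ` {..<n} \<subseteq> {..<d}"
  shows "cross_card ((\<lambda>i. b + k i) ` {..<n}) {b..<b + d} = (\<Sum>i<n. k i - i)"
proof -
  let ?k = "\<lambda>i. b + k i"
  have less: "k i < k j \<longleftrightarrow> i < j" if "i < n" "j < n" for i j
    using k that by (simp add: strict_mono_on_less)
  have inj: "inj_on ?k {..<n}"
    using k by (auto simp: inj_on_def strict_mono_on_eq)
  have "cross_card (?k ` {..<n}) {b..<b + d} =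
      (\<Sum>z\<in>?k ` {..<n}. card {s \<in> {b..<b + d} - ?k ` {..<n}. s < z})"
    using range by (intro cross_card_eq_sum) auto
  also have "\<dots> = (\<Sum>i<n. card {s \<in> {b..<b + d} - ?k ` {..<n}. s < ?k i})"
    by (simp add: sum.reindex[OF inj])
  also have "\<dots> = (\<Sum>i<n. k i - i)"
  proof (rule sum.cong[OF refl])
    fix i assume "i \<in> {..<n}"
    then have i: "i < n" "k i < d" using range by auto
    have "{s \<in> {b..<b + d} - ?k ` {..<n}. s < ?k i} = {b..<b + k i} - ?k ` {..<i}"
      using i less by auto
    moreover have "card ({b..<b + k i} - ?k ` {..<i}) = card {b..<b + k i} - card (?k ` {..<i})"
      using i less by (intro card_Diff_subset) auto
    moreover have "card (?k ` {..<i}) = i"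
      using i by (subst card_image[OF inj_on_subset[OF inj]]) auto
    ultimately show "card {s \<in> {b..<b + d} - ?k ` {..<n}. s < ?k i} = k i - i" by simp
  qed
  finally show ?thesis .
qed

section \<open>The partition attached to an array\<close>

text \<open>Since the shape of \<open>c\<close> is the conjugate of \<open>lam\<close>, the parts of
  \<open>lam\<close> are the column lengths of \<open>c\<close>.\<close>

definition col_length :: "(nat \<Rightarrow> nat \<Rightarrow> nat) \<Rightarrow> nat \<Rightarrow> nat" where
  "col_length c j = card {p. c p j \<noteq> 0}"

lemma col_length_eq: "col_length c j = card {p. 1 \<le> c p j}"
  by (simp add: col_length_def Suc_le_eq)

lemma col_length_nonzeroD:
  assumes c: "c \<in> CC n m" and nz: "col_length c j \<noteq> 0"
  shows "1 \<le> j" "j \<le> n"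
proof -
  have "{p. c p j \<noteq> 0} \<noteq> {}" using nz unfolding col_length_def by (metis card.empty)
  then obtain p where "c p j \<noteq> 0" by blast
  then show "1 \<le> j" "j \<le> n" using CC_nonzeroD(2)[OF c] CC_col_le[OF c] by auto
qed

lemma is_partition_col_length:
  assumes c: "c \<in> CC n m"
  shows "is_partition (col_length c)" "part_length (col_length c) \<le> n"
proof -
  have sub: "{i. col_length c i \<noteq> 0} \<subseteq> {1..n}" using col_length_nonzeroD[OF c] by auto
  then show "part_length (col_length c) \<le> n"
    unfolding part_length_def using card_mono[OF _ sub] by simp
  have "col_length c (Suc i) \<le> col_length c i" if "1 \<le> i" for i
    unfolding col_length_eq
  proof (rule card_mono)
    show "finite {p. 1 \<le> c p i}" by (rule finite_col_ge[OF c]) simp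
    show "{p. 1 \<le> c p (Suc i)} \<subseteq> {p. 1 \<le> c p i}"
    proof
      fix p assume "p \<in> {p. 1 \<le> c p (Suc i)}"
      then show "p \<in> {p. 1 \<le> c p i}" using CC_row_mono[OF c that, of "Suc i" p] by simp
    qed
  qed
  moreover have "col_length c 0 = 0" using col_length_nonzeroD(1)[OF c, of 0] by auto
  ultimately show "is_partition (col_length c)"
    using finite_subset[OF sub] by (simp add: is_partition_def)
qed

lemma part_conj_col_length:
  assumes c: "c \<in> CC n m"
  shows "part_conj (col_length c) = shape c"
proof
  fix p
  show "part_conj (col_length c) p = shape c p"
  proof (cases "p = 0")
    case True
    then show ?thesis using c by (simp add: part_conj_def shape_def CC_def plane_partition_def)
  next
    case False
    have iff: "p \<le> col_length c j \<longleftrightarrow> c p j \<noteq> 0" for j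
    proof -
      have "p \<in> {p. 1 \<le> c p j} \<longleftrightarrow> p \<in> {1..col_length c j}"
        unfolding col_length_eq using col_ge_eq[OF c, of 1 j] by blast
      then show ?thesis using False by auto
    qed
    have "{j. 1 \<le> j \<and> p \<le> col_length c j} = {j. c p j \<noteq> 0}"
      using CC_nonzeroD(2)[OF c, of p] unfolding iff by blast
    then show ?thesis using False by (simp add: part_conj_def shape_def)
  qed
qed

lemma path_pos_paths_of:
  assumes "c \<in> CC n m" "i < n"
  shows "path_pos (paths_of n c) 0 i = i + col_length c (n - i)"
  using tail_card_paths_of[OF assms(1) _ assms(2), of 1]
  by (simp add: path_pos_eq_tail_card col_length_eq)

text \<open>Path \<open>i\<close> ends at \<open>i + lam (n - i)\<close>; passing to indices from 1
  puts \<open>k = Suc i\<close> and gives the elements of \<open>I_set\<close>.\<close>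

lemma I_set_col_length:
  assumes c: "c \<in> CC n m"
  shows "I_set n (col_length c) = Suc ` path_pos (paths_of n c) 0 ` {..<n}"
proof -
  have "I_set n (col_length c) = (\<lambda>k. col_length c (n + 1 - k) + k) ` {1..n}"
    by (auto simp: I_set_def)
  also have "{1..n} = Suc ` {..<n}" by (simp add: lessThan_atLeast0 atLeastLessThanSuc_atLeastAtMost)
  also have "(\<lambda>k. col_length c (n + 1 - k) + k) ` (Suc ` {..<n}) =
      (\<lambda>i. Suc (path_pos (paths_of n c) 0 i)) ` {..<n}"
    unfolding image_image by (rule image_cong) (simp_all add: path_pos_paths_of[OF c])
  finally show ?thesis by (simp add: image_image)
qed

lemma part_size_col_length:
  assumes c: "c \<in> CC n m"
  shows "part_size (col_length c) = (\<Sum>i<n. path_pos (paths_of n c) 0 i - i)"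
proof -
  have "part_size (col_length c) = (\<Sum>j=1..n. col_length c j)"
    unfolding part_size_def using col_length_nonzeroD[OF c]
    by (intro sum.mono_neutral_left) auto
  also have "\<dots> = (\<Sum>i<n. col_length c (Suc i))" by (simp add: sum.atLeast1_atMost_eq)
  also have "\<dots> = (\<Sum>i<n. col_length c (Suc (n - Suc i)))"
    by (rule sum.nat_diff_reindex[symmetric])
  also have "\<dots> = (\<Sum>i<n. path_pos (paths_of n c) 0 i - i)"
    by (intro sum.cong refl) (simp add: path_pos_paths_of[OF c] Suc_diff_Suc)
  finally show ?thesis .
qed

text \<open>Conjugation is injective on partitions, so every array occurs for exactly one
  \<open>lam\<close>, its column lengths.\<close>

lemma Sum_any_over_shapes:
  fixes F :: "(nat \<Rightarrow> nat) \<Rightarrow> (nat \<Rightarrow> nat \<Rightarrow> nat) \<Rightarrow> 'a::comm_ring_1"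
  shows "Sum_any (\<lambda>lam. if is_partition lam \<and> part_length lam \<le> n
      then \<Sum>c\<in>{c \<in> CC n m. shape c = part_conj lam}. F lam c else 0) =
    (\<Sum>c\<in>CC n m. F (col_length c) c)"
proof -
  let ?G = "\<lambda>lam. if is_partition lam \<and> part_length lam \<le> n
      then \<Sum>c\<in>{c \<in> CC n m. shape c = part_conj lam}. F lam c else 0"
  have shape_iff: "shape c = part_conj lam \<longleftrightarrow> col_length c = lam"
    if "is_partition lam" "c \<in> CC n m" for lam c
    using part_conj_inj[OF is_partition_col_length(1)[OF that(2)] that(1)]
      part_conj_col_length[OF that(2)] by auto
  have G: "?G lam = (\<Sum>c\<in>{c \<in> CC n m. col_length c = lam}. F (col_length c) c)"
    if "lam \<in> col_length ` CC n m" for lam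
  proof -
    have "is_partition lam" "part_length lam \<le> n" using that is_partition_col_length by auto
    then show ?thesis using shape_iff by (auto intro!: sum.cong)
  qed
  have "Sum_any ?G = (\<Sum>lam\<in>col_length ` CC n m. ?G lam)"
  proof (rule Sum_any.expand_superset)
    show "finite (col_length ` CC n m)" by (simp add: finite_CC)
    show "{lam. ?G lam \<noteq> 0} \<subseteq> col_length ` CC n m"
    proof
      fix lam assume "lam \<in> {lam. ?G lam \<noteq> 0}"
      then have nz: "?G lam \<noteq> 0" by simp
      then have part: "is_partition lam" by (auto split: if_splits)
      have "{c \<in> CC n m. shape c = part_conj lam} \<noteq> {}"
      proof
        assume "{c \<in> CC n m. shape c = part_conj lam} = {}"
        then show False using nz by (simp only: sum.empty if_cancel) simp
      qed
      then show "lam \<in> col_length ` CC n m" using shape_iff[OF part] by auto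
    qed
  qed
  also have "\<dots> = (\<Sum>lam\<in>col_length ` CC n m. \<Sum>c\<in>{c \<in> CC n m. col_length c = lam}. F (col_length c) c)"
    by (rule sum.cong[OF refl G])
  also have "\<dots> = (\<Sum>c\<in>CC n m. F (col_length c) c)"
    by (rule sum.image_gen[OF finite_CC, symmetric])
  finally show ?thesis .
qed

lemma J_mat_mult_index:
  assumes "B \<in> carrier_mat n d" "i < n" "k < d"
  shows "(J_mat n * B) $$ (n - Suc i, k) = B $$ (i, k)"
proof -
  have "(J_mat n * B) $$ (n - Suc i, k) =
      (\<Sum>l = 0..<n. (if n - Suc i + l + 1 = n then 1 else 0) * B $$ (l, k))"
    using assms by (simp add: J_mat_def scalar_prod_def)
  also have "\<dots> = (\<Sum>l = 0..<n. if l = i then B $$ (l, k) else 0)"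
    using assms by (intro sum.cong refl) auto
  also have "\<dots> = B $$ (i, k)" using assms by simp
  finally show ?thesis .
qed

text \<open>Path \<open>i\<close> makes at most \<open>i + m\<close> steps and ends at most at
  \<open>2 * n - 2 + m\<close>; the lower bound on \<open>N\<close> is what makes this a column of
  \<open>B\<close>.\<close>

lemma bounded_families_position_less:
  assumes X: "X \<in> bounded_families n m" and "i < n" "n + m - 1 \<le> N"
  shows "path_pos X 0 i < n + N"
proof -
  have "card {l. (i, l) \<in> X \<and> 0 < l} \<le> card {0<..i + m}"
    using X by (intro card_mono) (auto simp: bounded_families_def)
  then show ?thesis using assms by (simp add: path_pos_def)
qed

text \<open>The Pfaffian expands over column sets \<open>K\<close>, and each minor over the families
  ending at \<open>K\<close>. Every bounded family ends at exactly one such \<open>K\<close>, so a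
  single sum over families remains.\<close>

lemma pfaffian_block_eq_sum_paths:
  fixes A :: "'a::comm_ring_1 mat"
  assumes N: "N = 2 * h" "n + m - 1 \<le> N" and A: "A \<in> carrier_mat (n + N) (n + N)"
  shows "pfaffian (four_block_mat (0\<^sub>m n n) (J_mat n * B_mat n m N t x)
      (- (transpose_mat (B_mat n m N t x)) * J_mat n) A) =
    (\<Sum>X\<in>bounded_families n m. (-1) ^ (\<Sum>i<n. path_pos X 0 i - i) *
       pfaffian (principal_submatrix A ({1..n + N} - Suc ` path_pos X 0 ` {..<n})) *
       path_weight (edge_weight n m t x) X)"
proof -
  let ?B = "B_mat n m N t x"
  let ?M = "four_block_mat (0\<^sub>m n n) (J_mat n * ?B) (- (transpose_mat ?B) * J_mat n) A"
  define a where "a i j = ?M $$ (i, j)" for i j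
  define S where "S = {n..<n + (n + N)}"
  define \<kappa> where "\<kappa> X = (\<lambda>i. n + path_pos X 0 i) ` {..<n}" for X
  let ?w = "path_weight (edge_weight n m t x)"
  let ?F = "bounded_families n m"
  have B: "?B \<in> carrier_mat n (n + N)" by (simp add: B_mat_def)
  have J: "J_mat n \<in> carrier_mat n n" by (simp add: J_mat_def)
  have dimA: "dim_row A = n + N" "dim_col A = n + N" using A by auto
  have a0: "a i j = 0" if "i < n" "j < n" for i j
    using that dimA by (simp add: a_def)
  have aB: "a (n - Suc i) (n + k) = row_coeff n m t x 0 i k" if "i < n" "k < n + N" for i k
  proof -
    have "a (n - Suc i) (n + k) = (J_mat n * ?B) $$ (n - Suc i, k)"
      using that dimA by (simp add: a_def)
    then show ?thesis
      using J_mat_mult_index[OF B that] B_mat_eq_row_coeff[OF that] by simp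
  qed
  have aA: "a (n + i) (n + j) = A $$ (i, j)" if "i < n + N" "j < n + N" for i j
    using that dimA by (simp add: a_def)
  have X_mono: "strict_mono_on {..<n} (path_pos X 0)" if "X \<in> ?F" for X
    using that by (simp add: bounded_families_def path_families_def)
  have X_range: "path_pos X 0 ` {..<n} \<subseteq> {..<n + N}" if "X \<in> ?F" for X
    using bounded_families_position_less[OF that _ N(2)] by auto
  have X_inj: "inj_on (path_pos X 0) {..<n}" if "X \<in> ?F" for X
    using strict_mono_on_imp_inj_on[OF X_mono[OF that]] .
  have \<kappa>: "\<kappa> X \<subseteq> S" "card (\<kappa> X) = n" if "X \<in> ?F" for X
  proof -
    show "\<kappa> X \<subseteq> S" using X_range[OF that] by (auto simp: \<kappa>_def S_def)
    show "card (\<kappa> X) = n"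
      unfolding \<kappa>_def using X_inj[OF that] by (subst card_image) (auto simp: inj_on_def)
  qed
  have minor: "row_minor n (\<lambda>i. a (n - Suc i)) K = (\<Sum>X\<in>{X \<in> ?F. \<kappa> X = K}. ?w X)"
    if K: "K \<subseteq> S" "card K = n" for K
  proof -
    \<comment> \<open>Columns of \<open>B\<close> start at index \<open>n\<close> of the block
      matrix; \<open>k\<close> enumerates \<open>K\<close> increasingly without this offset.\<close>
    define k where "k i = pick K i - n" for i
    have finK: "finite K" by (rule finite_subset[OF K(1)]) (simp add: S_def)
    have pick: "n \<le> pick K i \<and> pick K i < n + (n + N)" if "i < n" for i
      using pick_in_set[of i K] that K by (auto simp: S_def)
    have nk: "n + k i = pick K i" if "i < n" for i using pick[OF that] by (simp add: k_def)
    have k_mono: "strict_mono_on {..<n} k"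
    proof (rule strict_mono_onI)
      fix i j assume "i \<in> {..<n}" "j \<in> {..<n}" "i < j"
      then show "k i < k j" using strict_mono_onD[OF strict_mono_on_pick[of K], of i j] nk[of i] nk[of j] K
        by simp
    qed
    have K_eq: "(\<lambda>i. n + k i) ` {..<n} = K"
    proof -
      have "(\<lambda>i. n + k i) ` {..<n} = pick K ` {..<n}" by (rule image_cong) (simp_all add: nk)
      also have "\<dots> = K" using pick_image[OF finK] unfolding K(2) .
      finally show ?thesis .
    qed
    have "row_minor n (\<lambda>i. a (n - Suc i)) K = det (mat n n (\<lambda>(i, j). a (n - Suc i) (n + k j)))"
      unfolding K_eq[symmetric] using k_mono by (intro row_minor_eq_det) (simp add: strict_mono_on_def)
    also have "mat n n (\<lambda>(i, j). a (n - Suc i) (n + k j)) =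
        mat n n (\<lambda>(i, j). row_coeff n m t x 0 i (k j))"
    proof (rule eq_matI)
      fix i j assume "i < dim_row (mat n n (\<lambda>(i, j). row_coeff n m t x 0 i (k j)))"
        "j < dim_col (mat n n (\<lambda>(i, j). row_coeff n m t x 0 i (k j)))"
      then have ij: "i < n" "j < n" by auto
      then have "k j < n + N" using pick[of j] nk[of j] by simp
      then show "mat n n (\<lambda>(i, j). a (n - Suc i) (n + k j)) $$ (i, j) =
          mat n n (\<lambda>(i, j). row_coeff n m t x 0 i (k j)) $$ (i, j)"
        using ij aB by simp
    qed auto
    also have "det (mat n n (\<lambda>(i, j). row_coeff n m t x 0 i (k j))) =
        (\<Sum>X\<in>{X \<in> ?F. path_pos X 0 ` {..<n} = k ` {..<n}}. ?w X)"
      by (rule det_B_minor[OF k_mono])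
    also have "{X \<in> ?F. path_pos X 0 ` {..<n} = k ` {..<n}} = {X \<in> ?F. \<kappa> X = K}"
    proof -
      have "\<kappa> X = K \<longleftrightarrow> path_pos X 0 ` {..<n} = k ` {..<n}" for X
      proof -
        have "\<kappa> X = (+) n ` (path_pos X 0 ` {..<n})" "K = (+) n ` (k ` {..<n})"
          using K_eq by (auto simp: \<kappa>_def image_image)
        then show ?thesis by (simp only: inj_image_eq_iff[of "(+) n"] inj_def add_left_cancel simp_thms)
      qed
      then show ?thesis by auto
    qed
    finally show ?thesis .
  qed
  have "dim_row ?M = 2 * (n + h)" using dimA N(1) by simp
  then have "pfaffian ?M = set_pf a (n + h) {..<2 * (n + h)}"
    unfolding a_def by (rule pfaffian_eq_set_pf)
  also have "{..<2 * (n + h)} = {n - n..<n} \<union> S" using N(1) by (auto simp: S_def)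
  also have "set_pf a (n + h) ({n - n..<n} \<union> S) =
      (\<Sum>K\<in>{K. K \<subseteq> S \<and> card K = n}. (-1) ^ cross_card K S *
       row_minor n (\<lambda>i. a (n - Suc i)) K * set_pf a h (S - K))"
    by (rule set_pf_zero_block) (auto simp: a0 S_def)
  also have "\<dots> = (\<Sum>K\<in>{K. K \<subseteq> S \<and> card K = n}. \<Sum>X\<in>{X \<in> ?F. \<kappa> X = K}.
      (-1) ^ cross_card (\<kappa> X) S * ?w X * set_pf a h (S - \<kappa> X))"
  proof (rule sum.cong[OF refl])
    fix K assume "K \<in> {K. K \<subseteq> S \<and> card K = n}"
    then show "(-1) ^ cross_card K S * row_minor n (\<lambda>i. a (n - Suc i)) K * set_pf a h (S - K) =
      (\<Sum>X\<in>{X \<in> ?F. \<kappa> X = K}. (-1) ^ cross_card (\<kappa> X) S * ?w X * set_pf a h (S - \<kappa> X))"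
      by (simp add: minor sum_distrib_left sum_distrib_right)
  qed
  also have "\<dots> = (\<Sum>X\<in>?F. (-1) ^ cross_card (\<kappa> X) S * ?w X * set_pf a h (S - \<kappa> X))"
  proof (rule sum.group)
    show "finite ?F" using finite_path_families by (simp add: bounded_families_def)
    show "finite {K. K \<subseteq> S \<and> card K = n}" by (simp add: S_def)
    show "\<kappa> ` ?F \<subseteq> {K. K \<subseteq> S \<and> card K = n}" using \<kappa> by auto
  qed
  also have "\<dots> = (\<Sum>X\<in>?F. (-1) ^ (\<Sum>i<n. path_pos X 0 i - i) *
       pfaffian (principal_submatrix A ({1..n + N} - Suc ` path_pos X 0 ` {..<n})) * ?w X)"
  proof (rule sum.cong[OF refl])
    fix X assume X: "X \<in> ?F"
    have "card ({..<n + N} - path_pos X 0 ` {..<n}) = 2 * h"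
      using X_range[OF X] X_inj[OF X] N(1) by (simp add: card_Diff_subset card_image)
    then have "pfaffian (principal_submatrix A ({1..n + N} - Suc ` path_pos X 0 ` {..<n})) =
        set_pf a h ({n..<n + (n + N)} - (\<lambda>i. n + i) ` path_pos X 0 ` {..<n})"
      by (intro pfaffian_principal_submatrix A X_range[OF X] aA)
    also have "(\<lambda>i. n + i) ` path_pos X 0 ` {..<n} = \<kappa> X" by (simp add: \<kappa>_def image_image)
    finally have pf: "pfaffian (principal_submatrix A ({1..n + N} - Suc ` path_pos X 0 ` {..<n})) =
        set_pf a h (S - \<kappa> X)" by (simp add: S_def)
    have "cross_card (\<kappa> X) S = (\<Sum>i<n. path_pos X 0 i - i)"
      unfolding \<kappa>_def S_def by (rule cross_card_shifted[OF X_mono[OF X] X_range[OF X]])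
    then show "(-1) ^ cross_card (\<kappa> X) S * ?w X * set_pf a h (S - \<kappa> X) =
      (-1) ^ (\<Sum>i<n. path_pos X 0 i - i) *
       pfaffian (principal_submatrix A ({1..n + N} - Suc ` path_pos X 0 ` {..<n})) * ?w X"
      unfolding pf by (simp add: mult_ac)
  qed
  finally show ?thesis .
qed

theorem theorem7p2:
  fixes m n N :: nat
    and A :: "'a::comm_ring_1 mat"
    and t x :: "nat \<Rightarrow> 'a"
  assumes "n \<ge> 1"
    and "even N"
    and "N \<ge> n + m - 1"
    and "A \<in> carrier_mat (n + N) (n + N)"
    and "transpose_mat A = - A"
  shows "Sum_any (\<lambda>lam. if is_partition lam \<and> part_length lam \<le> n
           then \<Sum>c\<in>{c \<in> CC n m. shape c = part_conj lam}.
                  (-1) ^ part_size lam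
                  * pfaffian (principal_submatrix A ({1..n+N} - I_set n lam))
                  * cc_weight n m t x c
           else 0)
       = pfaffian (four_block_mat
           (0\<^sub>m n n)                                      (J_mat n * B_mat n m N t x)
           (- (transpose_mat (B_mat n m N t x)) * J_mat n)   A)"
proof -
  obtain h where h: "N = 2 * h" using assms(2) by (rule evenE)
  let ?term = "\<lambda>X. (-1) ^ (\<Sum>i<n. path_pos X 0 i - i) *
       pfaffian (principal_submatrix A ({1..n + N} - Suc ` path_pos X 0 ` {..<n})) *
       path_weight (edge_weight n m t x) X"
  have "(\<Sum>c\<in>CC n m. (-1) ^ part_size (col_length c)
          * pfaffian (principal_submatrix A ({1..n+N} - I_set n (col_length c)))
          * cc_weight n m t x c) = (\<Sum>c\<in>CC n m. ?term (paths_of n c))"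
    by (intro sum.cong refl)
       (simp only: part_size_col_length I_set_col_length cc_weight_eq_path_weight)
  also have "\<dots> = (\<Sum>X\<in>bounded_families n m. ?term X)"
    by (rule sum.reindex_bij_betw[OF bij_betw_paths_of])
  finally show ?thesis
    unfolding Sum_any_over_shapes pfaffian_block_eq_sum_paths[OF h assms(3,4)] .
qed

end
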